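(* Given real $\alpha>0$, $\delta\in(0,\alpha)$, $\kappa>\frac12$, and an integer $m\geq 1$, there exist an increasing sequence $\{\lambda_n\}_{n\geq1}$ of real numbers tending to infinity with $\lambda_1\geq 1$, and a sequence of non-negative real numbers $\{a_n\}_{n\geq 1}$, defining a general Dirichlet series $A(s)=\sum_{n=1}^\infty a_n\lambda_n^{-s}$ which satisfies all of the following: (i) The Dirichlet series $A(s)$ satisfies Hypothesis B with $\alpha,\delta,\kappa$ and $m$. (ii) As $n\to\infty$, $a_n=\Omega\Big(\lambda_n^{\alpha-\frac{\delta}{\kappa+1/2}}(\log\lambda_n)^{m-1}\Big)$. (iii) As $x\to\infty$, $\displaystyle\sum_{\lambda_n\leq x}a_n=\operatorname{Res}_{s=\alpha}\Big[A(s)\frac{x^s}{s}\Big]+\Omega\Big(x^{\alpha-\frac{\delta}{\kappa+1/2}}(\log x)^{m-1}\Big)$.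
   Context: The notation $f(x)=\Omega(g(x))$ means $\limsup_{x\to\infty}|f(x)/g(x)|>0$; (iii) means that the difference between the partial sum and the residue is $\Omega(\cdot)$ of the displayed function. Hypothesis B (for real $\alpha>0$, $\delta\in(0,\alpha)$, $\kappa\geq 0$ and integer $m\ge1$): The general Dirichlet series $A(s)=\sum_n a_n\lambda_n^{-s}$ with non-negative coefficients (well-defined for $s$ in an appropriate right half-plane) can be analytically continued to the region $\Re(s)\geq\alpha-\delta$ aside from a pole of order $m$ at the real point $s=\alpha$. Moreover, for some $M_1,M_2\geq 0$, $$|(s-\alpha)^mA(s)|\leq M_1\exp(|s|^{M_2})\quad\text{for all } s \text{ in the strip } \alpha-\delta\leq\Re(s)\leq\alpha,$$ and there exists $C\geq 1$ such that for $\Re(s)=\alpha-\delta$, $$|A(s)|\leq C(1+|\Im(s)|)^{\kappa}(\log(3+|\Im(s)|))^{m-1}.$$ *)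

theory Defs
  imports "HOL-Complex_Analysis.Complex_Analysis"
begin

text \<open>
  For eventually nonzero \<open>g\<close> this is the negation of \<open>f \<in> o[F](g)\<close>, a lower bound
  along some subsequence only.
  The relation \<open>f \<in> \<Omega>[F](g)\<close> of \<open>HOL-Library.Landau_Symbols\<close> is stronger, a lower bound
  holding eventually. The upper limit is taken in the extended reals, since it may be infinite.
\<close>
definition omega_limsup ::
    "'a filter \<Rightarrow> ('a \<Rightarrow> 'b::real_normed_field) \<Rightarrow> ('a \<Rightarrow> 'b) \<Rightarrow> bool" where
  "omega_limsup F f g \<longleftrightarrow> Limsup F (\<lambda>x. ereal (norm (f x / g x))) > 0"

text \<open>
  Sequences are indexed from 0, so \<open>lam 0\<close> and \<open>a 0\<close> are the first frequency and coefficient.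
\<close>
definition frequency_seq :: "(nat \<Rightarrow> real) \<Rightarrow> bool" where
  "frequency_seq lam \<longleftrightarrow> strict_mono lam \<and> filterlim lam at_top sequentially \<and> lam 0 \<ge> 1"

text \<open>
  The function \<open>A\<close> is the continued Dirichlet series. Analyticity on the closed half-plane means
  analyticity in a neighbourhood of each of its points other than \<open>\<alpha>\<close>. The value of \<open>A\<close> at the
  pole is irrelevant.
\<close>
definition hypothesis_B ::
    "(nat \<Rightarrow> real) \<Rightarrow> (nat \<Rightarrow> real) \<Rightarrow> (complex \<Rightarrow> complex) \<Rightarrow> real \<Rightarrow> real \<Rightarrow> real \<Rightarrow> nat \<Rightarrow> bool" where
  "hypothesis_B lam a A \<alpha> \<delta> \<kappa> m \<longleftrightarrow>
     0 < \<alpha> \<and> 0 < \<delta> \<and> \<delta> < \<alpha> \<and> 0 \<le> \<kappa> \<and> 1 \<le> m \<and>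
     frequency_seq lam \<and> (\<forall>n. a n \<ge> 0) \<and>
     (\<exists>\<sigma>::real. \<forall>s. Re s > \<sigma> \<longrightarrow>
        (\<lambda>n. complex_of_real (a n) * complex_of_real (lam n) powr (- s)) sums A s) \<and>
     A analytic_on ({s. Re s \<ge> \<alpha> - \<delta>} - {complex_of_real \<alpha>}) \<and>
     is_pole A (complex_of_real \<alpha>) \<and> zorder A (complex_of_real \<alpha>) = - int m \<and>
     (\<exists>M\<^sub>1 M\<^sub>2::real. M\<^sub>1 \<ge> 0 \<and> M\<^sub>2 \<ge> 0 \<and>
        (\<forall>s. \<alpha> - \<delta> \<le> Re s \<and> Re s \<le> \<alpha> \<and> s \<noteq> complex_of_real \<alpha> \<longrightarrow>
           norm ((s - complex_of_real \<alpha>) ^ m * A s) \<le> M\<^sub>1 * exp (norm s powr M\<^sub>2))) \<and>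
     (\<exists>C::real. C \<ge> 1 \<and>
        (\<forall>s. Re s = \<alpha> - \<delta> \<longrightarrow>
           norm (A s) \<le> C * (1 + \<bar>Im s\<bar>) powr \<kappa> * ln (3 + \<bar>Im s\<bar>) ^ (m - 1)))"

end

theory Submission imports Defs begin

text \<open>
  Write \<open>\<lambda> = exp u\<close>, \<open>r = m - 1\<close>, \<open>\<theta> = \<delta> / (\<kappa> + 1 / 2)\<close>. The measure \<open>u ^ r * exp (\<alpha> * u) du\<close> on
  \<open>u \<ge> 0\<close> has transform \<open>r! / (s - \<alpha>) ^ (r + 1)\<close>. It is replaced on each block \<open>[j, j + 1)\<close> by a
  Riemann sum over \<open>N j\<close> points. The error is \<open>O(|s|)\<close> by the mean value theorem and \<open>O(1)\<close> trivially,
  hence \<open>O(|s| ^ (1/2))\<close>, with constants that are summable over \<open>j\<close> when \<open>N j\<close> grows fast.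

  At \<open>u = j\<close> a spike \<open>J * exp (- s * j) * (1 - \<phi> s) ^ K\<close> is added, where \<open>K \<ge> \<kappa>\<close> and \<open>\<phi>\<close> is
  the transform of the uniform distribution on the grid points in \<open>(0, h]\<close>, \<open>h\<close> of order \<open>exp (- \<theta> * j)\<close>.
  Expanding the power gives the mass \<open>J\<close> at \<open>u = j\<close> and a signed density of size \<open>2 ^ K * J / h\<close>, which the
  original measure absorbs if \<open>J\<close> is a small multiple of \<open>h * j ^ r * exp (\<alpha> * j)\<close>; this is the
  required size of the coefficients. Since \<open>|1 - \<phi> s| \<le> min 2 (h * |s|)\<close>, on \<open>Re s = \<alpha> - \<delta>\<close> the spike
  is \<open>O(j ^ r * exp (\<delta> * j) * h * (h * |s|) ^ \<kappa>) = O(j ^ r * exp (- \<theta> * j / 2) * |s| ^ \<kappa>)\<close>, again summable.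

  A large coefficient is a jump of the partial sums, and the residue is continuous in \<open>x\<close>; so the
  partial sums inherit the lower bound.
\<close>

subsection \<open>Spikes with vanishing moments\<close>

text \<open>Generating polynomial of the uniform distribution on 1, ..., \<open>L\<close>. At
  \<open>z = exp (- s / N)\<close> it is the transform \<phi> of the uniform distribution on the
  first \<open>L\<close> grid points after a block's start.\<close>

definition avg_poly :: "nat \<Rightarrow> real poly" where
  "avg_poly L = (\<Sum>l=1..L. monom (1 / real L) l)"

lemma coeff_avg_poly: "coeff (avg_poly L) i = (if 1 \<le> i \<and> i \<le> L then 1 / real L else 0)"
  by (simp add: avg_poly_def coeff_sum)

lemma degree_avg_poly: "degree (avg_poly L) \<le> L"
  by (rule degree_le) (auto simp: coeff_avg_poly)

lemma poly_avg_poly_1: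
  assumes "L \<ge> 1"
  shows "poly (avg_poly L) 1 = 1"
  using assms by (simp add: avg_poly_def poly_sum poly_monom)

lemma coeff_power_nonneg:
  fixes p :: "'a :: linordered_idom poly"
  assumes "\<And>i. coeff p i \<ge> 0"
  shows "coeff (p ^ k) i \<ge> 0"
proof (induction k arbitrary: i)
  case 0
  then show ?case by (simp add: coeff_1)
next
  case (Suc k)
  then show ?case by (auto simp: coeff_mult intro!: sum_nonneg mult_nonneg_nonneg assms)
qed

lemma sum_coeff_le_poly_1:
  fixes p :: "'a :: linordered_idom poly"
  assumes "\<And>i. coeff p i \<ge> 0"
  shows "(\<Sum>i\<le>n. coeff p i) \<le> poly p 1"
proof -
  have "(\<Sum>i\<le>n. coeff p i) \<le> (\<Sum>i\<le>max n (degree p). coeff p i)"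
    by (rule sum_mono2) (auto simp: assms)
  also have "\<dots> = (\<Sum>i\<le>degree p. coeff p i)"
    by (rule sum.mono_neutral_right) (auto simp: coeff_eq_0)
  also have "\<dots> = poly p 1"
    by (simp add: poly_altdef)
  finally show ?thesis .
qed

text \<open>The coefficients of \<open>avg_poly L ^ k\<close> form a probability distribution.
  Convolving it with one of density at most \<open>1 / L\<close> keeps that density bound, whatever
  \<open>k\<close> is.\<close>

lemma coeff_avg_poly_power_Suc_le:
  assumes "L \<ge> 1"
  shows "\<bar>coeff (avg_poly L ^ Suc k) i\<bar> \<le> 1 / real L"
proof -
  let ?p = "avg_poly L ^ k"
  have nn: "coeff (avg_poly L ^ l) i \<ge> 0" for i l
    by (rule coeff_power_nonneg) (simp add: coeff_avg_poly)
  have "coeff (avg_poly L ^ Suc k) i = (\<Sum>j\<le>i. coeff (avg_poly L) j * coeff ?p (i - j))"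
    by (simp add: coeff_mult)
  also have "\<dots> \<le> (\<Sum>j\<le>i. 1 / real L * coeff ?p (i - j))"
    by (intro sum_mono mult_right_mono nn) (simp add: coeff_avg_poly)
  also have "\<dots> = (\<Sum>j\<le>i. coeff ?p j) / real L"
    using sum.nat_diff_reindex[of "coeff ?p" "Suc i"]
    by (simp add: lessThan_Suc_atMost flip: sum_divide_distrib del: sum.lessThan_Suc)
  also have "\<dots> \<le> poly ?p 1 / real L"
    by (intro divide_right_mono sum_coeff_le_poly_1 nn) auto
  finally show ?thesis
    using nn[of "Suc k" i] by (simp add: poly_avg_poly_1[OF assms] poly_power)
qed

text \<open>A factor \<open>1 - avg_poly L\<close> splits the product into a difference of two
  products with exponents \<open>j\<close> and \<open>j + 1\<close>, so each one doubles the bound.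
  The induction therefore needs \<open>j\<close> arbitrary.\<close>

lemma coeff_avg_poly_mix_le:
  assumes "L \<ge> 1"
  shows "\<bar>coeff (avg_poly L ^ Suc j * (1 - avg_poly L) ^ k) i\<bar> \<le> 2 ^ k / real L"
proof (induction k arbitrary: j)
  case 0
  then show ?case using coeff_avg_poly_power_Suc_le[OF assms] by simp
next
  case (Suc k)
  have "avg_poly L ^ Suc j * (1 - avg_poly L) ^ Suc k =
        avg_poly L ^ Suc j * (1 - avg_poly L) ^ k - avg_poly L ^ Suc (Suc j) * (1 - avg_poly L) ^ k"
    by (simp add: algebra_simps)
  then have "coeff (avg_poly L ^ Suc j * (1 - avg_poly L) ^ Suc k) i =
      coeff (avg_poly L ^ Suc j * (1 - avg_poly L) ^ k) i
      - coeff (avg_poly L ^ Suc (Suc j) * (1 - avg_poly L) ^ k) i"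
    by (metis coeff_diff)
  then show ?case
    using Suc.IH[of j] Suc.IH[of "Suc j"] by (simp add: field_simps abs_le_iff)
qed

text \<open>The unit mass at 0 together with its compensation. For \<open>L \<ge> 1\<close> it has a
  zero of order \<open>K\<close> at 1, that is, \<open>K\<close> vanishing moments.\<close>

definition spike_poly :: "nat \<Rightarrow> nat \<Rightarrow> real poly" where
  "spike_poly L K = (1 - avg_poly L) ^ K"

lemma coeff_spike_poly_0: "coeff (spike_poly L K) 0 = 1"
  by (simp add: spike_poly_def coeff_0_power coeff_avg_poly)

lemma coeff_spike_poly_le:
  assumes "L \<ge> 1" "i \<ge> 1"
  shows "\<bar>coeff (spike_poly L K) i\<bar> \<le> 2 ^ K / real L"
proof -
  \<comment> \<open>The sharper numerator closes the induction:
    \<open>(2 ^ K - 1) + 2 ^ K = 2 ^ Suc K - 1\<close>.\<close>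
  have "\<bar>coeff (spike_poly L K) i\<bar> \<le> (2 ^ K - 1) / real L"
  proof (induction K)
    case 0
    then show ?case using assms by (simp add: spike_poly_def coeff_1)
  next
    case (Suc K)
    have "spike_poly L (Suc K) = spike_poly L K - avg_poly L ^ Suc 0 * (1 - avg_poly L) ^ K"
      by (simp add: spike_poly_def algebra_simps)
    then have "coeff (spike_poly L (Suc K)) i =
        coeff (spike_poly L K) i - coeff (avg_poly L ^ Suc 0 * (1 - avg_poly L) ^ K) i"
      by (metis coeff_diff)
    then have "\<bar>coeff (spike_poly L (Suc K)) i\<bar> \<le> (2 ^ K - 1) / real L + 2 ^ K / real L"
      using coeff_avg_poly_mix_le[OF assms(1), of 0 K i] Suc.IH by linarith
    then show ?case by (simp add: add_divide_distrib diff_divide_distrib)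
  qed
  also have "\<dots> \<le> 2 ^ K / real L" by (simp add: divide_right_mono)
  finally show ?thesis .
qed

lemma degree_spike_poly: "degree (spike_poly L K) \<le> K * L"
proof -
  have "degree (1 - avg_poly L) \<le> L"
    by (rule degree_diff_le) (simp_all add: degree_avg_poly)
  then show ?thesis
    unfolding spike_poly_def using degree_power_le[of "1 - avg_poly L" K]
    by (metis le_trans mult.commute mult_le_mono2)
qed

section \<open>Spike polynomials at complex arguments and their size\<close>

lemma map_poly_of_real_mult:
  "map_poly of_real (p * q) = (map_poly of_real p * map_poly of_real q :: 'a :: {real_algebra_1,comm_ring_1} poly)"
  by (rule poly_eqI) (simp add: coeff_map_poly coeff_mult)

lemma map_poly_of_real_power:
  "map_poly of_real (p ^ n) = (map_poly of_real p ^ n :: 'a :: {real_algebra_1,comm_ring_1} poly)"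
  by (induction n) (simp_all add: map_poly_of_real_mult)

lemma map_poly_of_real_diff:
  "map_poly of_real (p - q) = (map_poly of_real p - map_poly of_real q :: 'a :: real_algebra_1 poly)"
  by (rule poly_eqI) (simp add: coeff_map_poly)

lemma poly_map_poly_of_real_sum:
  fixes z :: complex
  assumes "degree p < n"
  shows "(\<Sum>i<n. of_real (coeff p i) * z ^ i) = poly (map_poly of_real p) z"
proof -
  have d: "degree (map_poly of_real p :: complex poly) = degree p"
    by (rule degree_map_poly) auto
  have "poly (map_poly of_real p) z = (\<Sum>i\<le>degree p. of_real (coeff p i) * z ^ i)"
    by (simp add: poly_altdef d coeff_map_poly)
  also have "\<dots> = (\<Sum>i<n. of_real (coeff p i) * z ^ i)"
    by (rule sum.mono_neutral_left) (use assms in \<open>auto simp: coeff_eq_0\<close>)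
  finally show ?thesis ..
qed

text \<open>The degree is at most \<open>K * L\<close>, so under the hypothesis the sum over a block
  of \<open>n\<close> points captures the whole polynomial.\<close>

lemma sum_coeff_spike_poly:
  fixes z :: complex
  assumes "K * L < n"
  shows "(\<Sum>i<n. of_real (coeff (spike_poly L K) i) * z ^ i) = (1 - (\<Sum>l=1..L. z ^ l) / of_nat L) ^ K"
proof -
  have "(\<Sum>l=1..L. z ^ l / of_nat L) = (\<Sum>l<Suc L. of_real (coeff (avg_poly L) l) * z ^ l)"
    by (rule sum.mono_neutral_cong_left) (auto simp: coeff_avg_poly)
  also have "\<dots> = poly (map_poly of_real (avg_poly L)) z"
    by (rule poly_map_poly_of_real_sum) (simp add: less_Suc_eq_le degree_avg_poly)
  finally have "(\<Sum>l=1..L. z ^ l) / of_nat L = poly (map_poly of_real (avg_poly L)) z"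
    by (simp add: sum_divide_distrib)
  then show ?thesis
    using assms degree_spike_poly[of L K]
    by (subst poly_map_poly_of_real_sum)
       (auto simp: spike_poly_def map_poly_of_real_power map_poly_of_real_diff poly_power)
qed

text \<open>Mean value inequality on the convex right half-plane, where the derivative of
  \<open>exp (- z)\<close> has norm at most 1.\<close>

lemma norm_one_minus_exp_neg_le:
  fixes z :: complex
  assumes "Re z \<ge> 0"
  shows "norm (1 - exp (- z)) \<le> norm z"
proof -
  have "norm (exp (- z) - exp (- 0)) \<le> 1 * norm (z - 0)"
  proof (rule field_differentiable_bound[where S = "{z. Re z \<ge> 0}" and f' = "\<lambda>z. - exp (- z)"])
    show "convex {z. 0 \<le> Re z}" by (rule convex_halfspace_Re_ge)
  qed (use assms in \<open>auto intro!: derivative_eq_intros\<close>)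
  then show ?thesis by (simp add: norm_minus_commute)
qed

text \<open>The factor is an average of \<open>L\<close> terms \<open>1 - exp (- s * x * l)\<close>.
  Each is at most 2 trivially, and at most \<open>norm s * (x * L)\<close> because
  \<open>l \<le> L\<close>.\<close>

lemma norm_spike_factor_le:
  fixes s :: complex
  assumes "Re s \<ge> 0" "L \<ge> 1" "x \<ge> 0"
  shows "norm (1 - (\<Sum>l=1..L. exp (- s * of_real x) ^ l) / of_nat L) \<le> min 2 (norm s * (x * L))"
proof -
  have eq: "exp (- s * of_real x) ^ l = exp (- (s * of_real (x * l)))" for l
    by (simp add: exp_of_nat_mult[symmetric] mult_ac)
  have "1 - (\<Sum>l=1..L. exp (- s * of_real x) ^ l) / of_nat L =
      (\<Sum>l=1..L. 1 - exp (- (s * of_real (x * l)))) / of_nat L"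
    unfolding eq using assms by (simp add: sum_subtractf diff_divide_distrib)
  then have n: "norm (1 - (\<Sum>l=1..L. exp (- s * of_real x) ^ l) / of_nat L) =
      norm (\<Sum>l=1..L. 1 - exp (- (s * of_real (x * l)))) / L"
    by (simp add: norm_divide)
  have "norm (\<Sum>l=1..L. 1 - exp (- (s * of_real (x * l)))) \<le> (\<Sum>l=1..L. norm s * (x * L))"
  proof (rule sum_norm_le)
    fix l assume l: "l \<in> {1..L}"
    have "norm (1 - exp (- (s * of_real (x * l)))) \<le> norm (s * of_real (x * l))"
        using assms by (intro norm_one_minus_exp_neg_le) (simp add: mult_nonneg_nonneg)
    also have "\<dots> \<le> norm s * (x * L)"
      using l assms(3) by (auto simp: norm_mult intro!: mult_left_mono)
    finally show "norm (1 - exp (- (s * of_real (x * l)))) \<le> norm s * (x * L)" .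
  qed
  moreover have "norm (\<Sum>l=1..L. 1 - exp (- (s * of_real (x * l)))) \<le> (\<Sum>l=1..L. 2)"
  proof (rule sum_norm_le)
    fix l :: nat
    have "norm (1 - exp (- (s * of_real (x * l)))) \<le> norm (1::complex) + norm (exp (- (s * of_real (x * l))))"
      by (rule norm_triangle_ineq4)
    also have "\<dots> \<le> 2"
      using assms mult_nonneg_nonneg[of "Re s" "x * l"] by simp
    finally show "norm (1 - exp (- (s * of_real (x * l)))) \<le> 2" .
  qed
  ultimately show ?thesis
    unfolding n using assms(2) by (simp add: field_simps)
qed

text \<open>Trades the integer order \<open>K\<close> of vanishing for the real exponent \<kappa>:
  for \<open>y \<ge> 1\<close> the factor \<open>2 ^ K\<close> suffices, and for
  \<open>y < 1\<close> lowering the exponent only increases the power.\<close>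

lemma min_two_power_le:
  fixes y \<kappa> :: real
  assumes "0 \<le> y" "0 < \<kappa>" "\<kappa> \<le> real K"
  shows "min 2 y ^ K \<le> 2 ^ K * y powr \<kappa>"
proof (cases "y \<ge> 1")
  case True
  have "min 2 y ^ K \<le> 2 ^ K * 1" using assms by (simp add: power_mono)
  also have "\<dots> \<le> 2 ^ K * y powr \<kappa>"
    using True assms by (intro mult_left_mono ge_one_powr_ge_zero) auto
  finally show ?thesis .
next
  case False
  show ?thesis
  proof (cases "y = 0")
    \<comment> \<open>Positivity of \<kappa> forces \<open>K \<ge> 1\<close>, so both sides are 0
      here.\<close>
    case True
    with assms show ?thesis by (simp add: power_0_left)
  next
    case 0: False
    have "min 2 y ^ K = y powr real K"
      using False 0 assms by (simp add: powr_realpow)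
    also have "\<dots> \<le> 1 * y powr \<kappa>" using False 0 assms by (simp add: powr_mono')
    also have "\<dots> \<le> 2 ^ K * y powr \<kappa>" by (intro mult_right_mono) auto
    finally show ?thesis .
  qed
qed

subsection \<open>Riemann sums of \<open>u ^ n * exp (- w * u)\<close>\<close>

text \<open>Repeated integration by parts of \<open>u ^ n * exp (- w * u)\<close> in
  \<open>u\<close>, normalised to vanish at infinity when \<open>Re w > 0\<close>. The formula makes
  sense for all \<open>w \<noteq> 0\<close>, which provides the continuation in
  \<open>w\<close>.\<close>

primrec power_exp_antideriv :: "nat \<Rightarrow> complex \<Rightarrow> complex \<Rightarrow> complex" where
  "power_exp_antideriv 0 w u = - exp (- w * u) / w"
| "power_exp_antideriv (Suc n) w u =
     - (u ^ Suc n) * exp (- w * u) / w + of_nat (Suc n) / w * power_exp_antideriv n w u"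

lemma has_field_derivative_power_exp_antideriv:
  assumes "w \<noteq> 0"
  shows "(power_exp_antideriv n w has_field_derivative u ^ n * exp (- w * u)) (at u within S)"
proof (induction n)
  case 0
  show ?case using assms by (auto intro!: derivative_eq_intros)
next
  case (Suc n)
  show ?case using assms
    by (auto intro!: derivative_eq_intros Suc simp: field_simps) (cases n; simp)
qed

text \<open>The negative of this value is the integral over \<open>u \<ge> 0\<close> for
  \<open>Re w > 0\<close>; it produces the pole of the final series.\<close>

lemma power_exp_antideriv_0: "w \<noteq> 0 \<Longrightarrow> power_exp_antideriv n w 0 = - fact n / w ^ Suc n"
  by (induction n) (simp_all add: mult_ac)

lemma holomorphic_power_exp_antideriv:
  assumes "0 \<notin> S"
  shows "(\<lambda>w. power_exp_antideriv n w u) holomorphic_on S"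
proof (induction n)
  case 0
  show ?case using assms by (auto intro!: holomorphic_intros)
next
  case (Suc n)
  show ?case unfolding power_exp_antideriv.simps using assms
    by (intro holomorphic_intros Suc) auto
qed

lemma tendsto_power_exp_antideriv:
  assumes "Re w > 0"
  shows "(\<lambda>j. power_exp_antideriv n w (of_nat j)) \<longlonglongrightarrow> 0"
proof (induction n)
  have l: "(\<lambda>j. of_nat j ^ n * exp (- w * of_nat j)) \<longlonglongrightarrow> 0" for n
  proof (rule tendsto_norm_zero_cancel)
    have "((\<lambda>j. real j ^ n * exp (- Re w * real j)) \<longlonglongrightarrow> 0)"
      using assms by real_asymp
    then show "(\<lambda>j. norm (of_nat j ^ n * exp (- w * of_nat j))) \<longlonglongrightarrow> 0"
      by (simp add: norm_mult norm_power)
  qed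
  {
    case 0
    show ?case using tendsto_mult_right[OF l[of 0], of "- inverse w"]
      by (simp add: field_simps)
  next
    case (Suc n)
    have "(\<lambda>j. - inverse w * (of_nat j ^ Suc n * exp (- w * of_nat j))
        + of_nat (Suc n) / w * power_exp_antideriv n w (of_nat j)) \<longlonglongrightarrow> - inverse w * 0 + of_nat (Suc n) / w * 0"
      by (intro tendsto_intros l Suc)
    then show ?case by (simp add: field_simps)
  }
qed

text \<open>Mean value inequality and first-order Taylor expansion of \<open>Q\<close> on the
  segment from \<open>x\<close> to \<open>y\<close>. There \<open>Q' = F\<close> is at most
  \<open>B\<close>, since \<open>- Re w * u \<le> b * (j + 1)\<close>, and \<open>F'\<close> is at
  most \<open>(n + norm w) * B\<close>.\<close>

lemma power_exp_cell_bounds: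
  fixes w :: complex and b :: real and n j :: nat
  assumes "w \<noteq> 0" "Re w \<ge> - b" "b \<ge> 0" "0 \<le> x" "x \<le> y" "y \<le> real (Suc j)"
  defines "F \<equiv> (\<lambda>u :: complex. u ^ n * exp (- w * u))"
    and "Q \<equiv> power_exp_antideriv n w"
    and "B \<equiv> real (Suc j) ^ n * exp (b * real (Suc j))"
  shows "norm (Q y - Q x) \<le> B * (y - x)"
    and "norm (F x) \<le> B"
    and "norm (Q y - Q x - F x * (y - x)) \<le> (n + norm w) * B * (y - x)\<^sup>2"
proof -
  \<comment> \<open>For \<open>n = 0\<close> the truncated exponent \<open>n - 1\<close> is
    harmless, since its term has the factor \<open>n\<close>.\<close>
  define F' where "F' u = of_nat n * u ^ (n - 1) * exp (- w * u) - w * (u ^ n * exp (- w * u))" for u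
  define S where "S = closed_segment (complex_of_real x) (of_real y)"
  have Q: "(Q has_field_derivative F u) (at u within S)" for u
    unfolding Q_def F_def by (rule has_field_derivative_power_exp_antideriv) fact
  have F: "(F has_field_derivative F' u) (at u within S)" for u
    unfolding F_def F'_def by (auto intro!: derivative_eq_intros simp: algebra_simps)
  have S: "\<exists>v. u = of_real v \<and> 0 \<le> v \<and> v \<le> real (Suc j)" if "u \<in> S" for u
    using that assms(4-6) unfolding S_def closed_segment_of_real closed_segment_eq_real_ivl by auto
  have e: "exp (- Re w * v) \<le> exp (b * real (Suc j))" if "0 \<le> v" "v \<le> real (Suc j)" for v
  proof -
    have "- Re w * v \<le> b * v" using assms(2) that by (intro mult_right_mono) auto
    also have "\<dots> \<le> b * real (Suc j)" using assms(3) that by (intro mult_left_mono) auto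
    finally show ?thesis by simp
  qed
  have Fb: "norm (F u) \<le> B" if u: "u \<in> S" for u
  proof -
    obtain v where v: "u = of_real v" "0 \<le> v" "v \<le> real (Suc j)" using S[OF u] by blast
    have "norm (F u) = v ^ n * exp (- Re w * v)"
      using v by (simp add: F_def norm_mult norm_power)
    also have "\<dots> \<le> B" unfolding B_def using v
      by (intro mult_mono power_mono e) auto
    finally show ?thesis .
  qed
  have Fb': "norm (F' u) \<le> (n + norm w) * B" if u: "u \<in> S" for u
  proof -
    obtain v where v: "u = of_real v" "0 \<le> v" "v \<le> real (Suc j)" using S[OF u] by blast
    have "v ^ (n - 1) \<le> real (Suc j) ^ (n - 1)" using v by (intro power_mono) auto
    also have "\<dots> \<le> real (Suc j) ^ n" by (intro power_increasing) auto
    finally have "v ^ (n - 1) * exp (- Re w * v) \<le> B"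
      unfolding B_def using v by (intro mult_mono e) auto
    then have "real n * (v ^ (n - 1) * exp (- Re w * v)) \<le> n * B"
      by (intro mult_left_mono) auto
    moreover have "norm (of_nat n * u ^ (n - 1) * exp (- w * u)) = real n * (v ^ (n - 1) * exp (- Re w * v))"
      using v by (simp add: norm_mult norm_power)
    moreover have "norm (w * (u ^ n * exp (- w * u))) \<le> norm w * B"
      unfolding norm_mult[of w] using Fb[OF u] by (intro mult_left_mono) (auto simp: F_def)
    ultimately have "norm (F' u) \<le> real n * B + norm w * B"
      unfolding F'_def by (intro order_trans[OF norm_triangle_ineq4] add_mono) simp_all
    then show ?thesis by (simp add: distrib_right)
  qed
  have mem: "of_real x \<in> S" "of_real y \<in> S" by (simp_all add: S_def)
  show "norm (F x) \<le> B" using Fb mem by blast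
  have nrm: "norm (complex_of_real y - of_real x) = y - x"
    using assms(5) by (metis abs_of_nonneg diff_ge_0_iff_ge norm_of_real of_real_diff)
  show "norm (Q y - Q x) \<le> B * (y - x)"
    using field_differentiable_bound[OF _ Q Fb mem(2,1)] nrm by (simp add: S_def)
  \<comment> \<open>The Taylor theorem takes the successive derivatives as one indexed family; only
    the indices 0, 1 and 2 matter.\<close>
  define f where "f k = (if k = 0 then Q else if k = 1 then F else F')" for k :: nat
  have "norm (f 0 (of_real y) - (\<Sum>i\<le>1. f i (of_real x) * (of_real y - of_real x) ^ i / fact i))
      \<le> (n + norm w) * B * norm (complex_of_real y - of_real x) ^ Suc 1 / fact 1"
  proof (rule complex_Taylor[where S = S])
    show "convex S" by (simp add: S_def)
    show "(f i has_field_derivative f (Suc i) u) (at u within S)" if "i \<le> 1" for i u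
      using that Q F by (cases "i = 0") (auto simp: f_def)
  qed (use Fb' mem in \<open>auto simp: f_def\<close>)
  then show "norm (Q y - Q x - F x * (y - x)) \<le> (n + norm w) * B * (y - x)\<^sup>2"
    unfolding nrm by (simp add: f_def power2_eq_square algebra_simps)
qed

text \<open>The first bound is uniform in \<open>w\<close>; the second gains \<open>1 / N\<close> at
  the cost of a factor \<open>norm w\<close>. Their geometric mean grows only like the square root
  of \<open>norm w\<close>.\<close>

lemma riemann_sum_power_exp_error:
  fixes w :: complex and b :: real and n j :: nat
  assumes "w \<noteq> 0" "Re w \<ge> - b" "b \<ge> 0" "N \<ge> 1"
  defines "F \<equiv> (\<lambda>u :: complex. u ^ n * exp (- w * u))"
    and "Q \<equiv> power_exp_antideriv n w"
    and "B \<equiv> real (Suc j) ^ n * exp (b * real (Suc j))"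
  defines "E \<equiv> (\<Sum>i<N. F (of_real (real j + real i / real N)) / of_nat N) - (Q (of_nat (Suc j)) - Q (of_nat j))"
  shows "norm E \<le> 2 * B" and "norm E \<le> (n + norm w) * B / N"
proof -
  define p where "p i = real j + real i / real N" for i
  define d where "d i = F (of_real (p i)) / of_nat N - (Q (of_real (p (Suc i))) - Q (of_real (p i)))" for i
  have "Q (of_nat (Suc j)) - Q (of_nat j) = Q (of_real (p N)) - Q (of_real (p 0))"
    using assms(4) by (simp add: p_def add.commute)
  also have "\<dots> = (\<Sum>i<N. Q (of_real (p (Suc i))) - Q (of_real (p i)))"
    by (rule sum_lessThan_telescope[symmetric])
  finally have E: "E = (\<Sum>i<N. d i)"
    by (simp add: E_def d_def p_def sum_subtractf)
  have step: "p (Suc i) - p i = 1 / N" for i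
    by (simp add: p_def add_divide_distrib)
  have cell: "norm (Q (p (Suc i)) - Q (p i)) \<le> B * (1 / N)" "norm (F (p i)) \<le> B"
    "norm (Q (p (Suc i)) - Q (p i) - F (p i) * (1 / N)) \<le> (n + norm w) * B * (1 / N)\<^sup>2" if "i < N" for i
  proof -
    have "real (Suc i) / N \<le> 1" using that by simp
    then have "p (Suc i) \<le> real (Suc j)" by (simp add: p_def)
    moreover have "p i \<le> p (Suc i)" "0 \<le> p i" by (simp_all add: p_def divide_right_mono)
    ultimately show "norm (Q (p (Suc i)) - Q (p i)) \<le> B * (1 / N)" "norm (F (p i)) \<le> B"
      "norm (Q (p (Suc i)) - Q (p i) - F (p i) * (1 / N)) \<le> (n + norm w) * B * (1 / N)\<^sup>2"
      using power_exp_cell_bounds[OF assms(1-3), of "p i" "p (Suc i)" j n] step[of i]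
      unfolding F_def Q_def B_def of_real_diff[symmetric] by simp_all
  qed
  have "norm E \<le> (\<Sum>i<N. 2 * B * (1 / N))" unfolding E
  proof (rule sum_norm_le)
    fix i assume "i \<in> {..<N}"
    then have i: "i < N" by simp
    have "norm (F (p i) / of_nat N) \<le> B * (1 / N)"
      using cell(2)[OF i] by (simp add: norm_divide divide_right_mono)
    moreover have "norm (d i) \<le> norm (F (p i) / of_nat N) + norm (Q (p (Suc i)) - Q (p i))"
      unfolding d_def by (rule norm_triangle_ineq4)
    ultimately show "norm (d i) \<le> 2 * B * (1 / N)"
      using cell(1)[OF i] by linarith
  qed
  then show "norm E \<le> 2 * B" using assms(4) by simp
  have "norm E \<le> (\<Sum>i<N. (n + norm w) * B * (1 / N)\<^sup>2)" unfolding E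
  proof (rule sum_norm_le)
    fix i assume "i \<in> {..<N}"
    then have i: "i < N" by simp
    have "d i = - (Q (p (Suc i)) - Q (p i) - F (p i) * (1 / N))"
      by (simp add: d_def)
    with cell(3)[OF i] show "norm (d i) \<le> (n + norm w) * B * (1 / N)\<^sup>2"
      by (metis norm_minus_cancel)
  qed
  then show "norm E \<le> (n + norm w) * B / N"
    using assms(4) by (simp add: power2_eq_square)
qed

subsection \<open>Enumerating a union of finite blocks\<close>

text \<open>Blocks of lengths \<open>N 0\<close>, \<open>N 1\<close>, ... are laid end to end, so
  that one index \<open>n\<close> encodes a block and an offset in it.\<close>

definition block_start :: "(nat \<Rightarrow> nat) \<Rightarrow> nat \<Rightarrow> nat" where
  "block_start N j = (\<Sum>l<j. N l)"

definition block_index :: "(nat \<Rightarrow> nat) \<Rightarrow> nat \<Rightarrow> nat" where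
  "block_index N n = (LEAST j. n < block_start N (Suc j))"

definition block_offset :: "(nat \<Rightarrow> nat) \<Rightarrow> nat \<Rightarrow> nat" where
  "block_offset N n = n - block_start N (block_index N n)"

text \<open>Block \<open>j\<close> samples the interval from \<open>j\<close> to
  \<open>j + 1\<close>, right end excluded, at \<open>N j\<close> equally spaced points starting at
  \<open>j\<close>.\<close>

definition block_point :: "(nat \<Rightarrow> nat) \<Rightarrow> nat \<Rightarrow> real" where
  "block_point N n = real (block_index N n) + real (block_offset N n) / real (N (block_index N n))"

lemma block_start_mono: "i \<le> j \<Longrightarrow> block_start N i \<le> block_start N j"
  unfolding block_start_def by (rule sum_mono2) auto

lemma block_index_start_add:
  assumes "i < N j"
  shows "block_index N (block_start N j + i) = j"
  unfolding block_index_def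
proof (rule Least_equality)
  show "block_start N j + i < block_start N (Suc j)"
    using assms by (simp add: block_start_def)
next
  fix k assume "block_start N j + i < block_start N (Suc k)"
  then show "j \<le> k" using block_start_mono[of "Suc k" j N] by linarith
qed

lemma block_offset_start_add: "i < N j \<Longrightarrow> block_offset N (block_start N j + i) = i"
  by (simp add: block_offset_def block_index_start_add)

lemma sum_lessThan_add:
  fixes g :: "nat \<Rightarrow> 'a :: comm_monoid_add"
  shows "(\<Sum>n<a + k. g n) = (\<Sum>n<a. g n) + (\<Sum>i<k. g (a + i))"
  by (induction k) (simp_all add: add.assoc)

lemma sum_block_start:
  fixes g :: "nat \<Rightarrow> nat \<Rightarrow> 'a :: comm_monoid_add"
  shows "(\<Sum>n<block_start N J. g (block_index N n) (block_offset N n)) = (\<Sum>j<J. \<Sum>i<N j. g j i)"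
proof (induction J)
  case 0
  then show ?case by (simp add: block_start_def)
next
  case (Suc J)
  have "block_start N (Suc J) = block_start N J + N J" by (simp add: block_start_def)
  then show ?case
    by (simp add: sum_lessThan_add Suc block_index_start_add block_offset_start_add)
qed

context
  fixes N :: "nat \<Rightarrow> nat"
  assumes N_pos: "\<And>j. N j \<ge> 1"
begin

lemma strict_mono_block_start: "strict_mono (block_start N)"
  unfolding strict_mono_Suc_iff block_start_def using N_pos by (simp add: Suc_le_eq)

text \<open>Past the last offset the next index opens block \<open>j + 1\<close>, which is
  non-empty.\<close>

lemma ex_block: "\<exists>j i. n = block_start N j + i \<and> i < N j"
proof (induction n)
  case 0
  then show ?case using N_pos[of 0] by (intro exI[of _ 0]) (simp add: block_start_def)
next
  case (Suc n)
  then obtain j i where ji: "n = block_start N j + i" "i < N j" by blast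
  show ?case
  proof (cases "Suc i < N j")
    case True
    with ji show ?thesis by (intro exI[of _ j] exI[of _ "Suc i"]) simp
  next
    case False
    with ji have "Suc n = block_start N (Suc j) + 0" by (simp add: block_start_def)
    with N_pos[of "Suc j"] show ?thesis by (metis One_nat_def Suc_le_eq)
  qed
qed

lemma block_point_start_add: "i < N j \<Longrightarrow> block_point N (block_start N j + i) = real j + real i / real (N j)"
  by (simp add: block_point_def block_index_start_add block_offset_start_add)

lemma block_point_start: "block_point N (block_start N j) = real j"
  using block_point_start_add[of 0 j] N_pos[of j] by simp

text \<open>Inside a block the step is \<open>1 / N j\<close>; the last point of block
  \<open>j\<close> lies below \<open>j + 1\<close>, where the next block starts.\<close>

lemma strict_mono_block_point: "strict_mono (block_point N)"
  unfolding strict_mono_Suc_iff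
proof
  fix n
  obtain j i where ji: "n = block_start N j + i" "i < N j" using ex_block by blast
  show "block_point N n < block_point N (Suc n)"
  proof (cases "Suc i < N j")
    case True
    then show ?thesis
      using ji block_point_start_add[of "Suc i" j] block_point_start_add[of i j]
      by (simp add: divide_strict_right_mono)
  next
    case False
    with ji have "Suc n = block_start N (Suc j)" by (simp add: block_start_def)
    then have "block_point N (Suc n) = real (Suc j)" by (simp only: block_point_start)
    moreover have "real i / real (N j) < 1" using ji by simp
    ultimately show ?thesis using ji block_point_start_add[of i j] by simp
  qed
qed

lemma filterlim_block_point: "filterlim (block_point N) at_top sequentially"
  unfolding filterlim_at_top
proof
  fix Z :: real
  obtain j :: nat where "Z \<le> real j" using real_arch_simple by blast
  then have "Z \<le> block_point N n" if "n \<ge> block_start N j" for n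
    using that strict_mono_block_point block_point_start[of j]
    by (metis order_trans strict_mono_less_eq)
  then show "\<forall>\<^sub>F n in sequentially. Z \<le> block_point N n"
    using eventually_sequentially by blast
qed

lemma frequency_seq_exp_block_point: "frequency_seq (\<lambda>n. exp (block_point N n))"
  unfolding frequency_seq_def
proof (intro conjI)
  show "strict_mono (\<lambda>n. exp (block_point N n))"
    using strict_mono_block_point by (simp add: strict_mono_def)
  show "filterlim (\<lambda>n. exp (block_point N n)) at_top sequentially"
    by (rule filterlim_compose[OF exp_at_top filterlim_block_point])
  show "1 \<le> exp (block_point N 0)" by (simp add: block_point_def)
qed

text \<open>Absolute convergence is only checked along the block boundaries at the real point \<open>Re s\<close>,
  which suffices as the terms there are non-negative.\<close>
lemma sums_of_block_sums:
  fixes c :: "nat \<Rightarrow> nat \<Rightarrow> real" and s :: complex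
  assumes nonneg: "\<And>j i. i < N j \<Longrightarrow> c j i \<ge> 0"
    and lim: "\<And>t. Re t = Re s \<Longrightarrow>
      (\<lambda>J. \<Sum>j<J. \<Sum>i<N j. of_real (c j i) * exp (- t * of_real (real j + real i / N j))) \<longlonglongrightarrow> S t"
  shows "(\<lambda>n. of_real (c (block_index N n) (block_offset N n)) * of_real (exp (block_point N n)) powr (- s)) sums S s"
proof -
  define T :: "complex \<Rightarrow> nat \<Rightarrow> complex" where "T t n = of_real (c (block_index N n) (block_offset N n)) * exp (- t * of_real (block_point N n))" for t n
  have T: "(\<Sum>n<block_start N J. T t n) =
      (\<Sum>j<J. \<Sum>i<N j. of_real (c j i) * exp (- t * of_real (real j + real i / N j)))" for t J
    unfolding T_def block_point_def by (rule sum_block_start)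
  have cn: "c (block_index N n) (block_offset N n) \<ge> 0" for n
    using ex_block[of n] nonneg by (auto simp: block_index_start_add block_offset_start_add)
  let ?r = "complex_of_real (Re s)"
  have Tr: "T ?r n = of_real (norm (T s n))" for n
  proof -
    have "T ?r n = of_real (c (block_index N n) (block_offset N n) * exp (- Re s * block_point N n))"
      unfolding T_def by (simp flip: exp_of_real)
    moreover have "norm (T s n) = c (block_index N n) (block_offset N n) * exp (- Re s * block_point N n)"
      unfolding T_def using cn[of n] by (simp add: norm_mult)
    ultimately show ?thesis by simp
  qed
  have "Bseq (\<lambda>J. \<Sum>n<block_start N J. T ?r n)"
    unfolding T using lim[of ?r] by (intro convergent_imp_Bseq convergentI) auto
  then obtain M where M: "\<And>J. norm (\<Sum>n<block_start N J. T ?r n) \<le> M"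
    unfolding Bseq_def by blast
  have "summable (\<lambda>n. norm (T s n))"
  proof (rule summableI_nonneg_bounded)
    fix n
    have "(\<Sum>i<n. norm (T s i)) \<le> (\<Sum>i<block_start N n. norm (T s i))"
      using strict_mono_imp_increasing[OF strict_mono_block_start, of n] by (intro sum_mono2) auto
    also have "\<dots> = norm (\<Sum>i<block_start N n. T ?r i)"
      unfolding Tr of_real_sum[symmetric] norm_of_real by (simp add: sum_nonneg)
    also have "\<dots> \<le> M" by (rule M)
    finally show "(\<Sum>i<n. norm (T s i)) \<le> M" .
  qed auto
  then have "T s sums (\<Sum>n. T s n)" using summable_norm_cancel summable_sums by blast
  then have "(\<lambda>n. \<Sum>i<n. T s i) \<longlonglongrightarrow> (\<Sum>n. T s n)" by (simp add: sums_def)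
  \<comment> \<open>The full series converges, so its limit along the block boundaries identifies
    the sum.\<close>
  from LIMSEQ_subseq_LIMSEQ[OF this strict_mono_block_start]
  have "(\<lambda>J. \<Sum>n<block_start N J. T s n) \<longlonglongrightarrow> (\<Sum>n. T s n)" by (simp add: o_def)
  moreover have "(\<lambda>J. \<Sum>n<block_start N J. T s n) \<longlonglongrightarrow> S s"
    unfolding T using lim by blast
  ultimately have "(\<Sum>n. T s n) = S s" by (rule LIMSEQ_unique)
  with \<open>T s sums _\<close> have "T s sums S s" by simp
  moreover have "T s = (\<lambda>n. of_real (c (block_index N n) (block_offset N n)) * of_real (exp (block_point N n)) powr (- s))"
    by (simp add: T_def powr_def Ln_of_real fun_eq_iff)
  ultimately show ?thesis by simp
qed

end

subsection \<open>Lower bounds from jumps, residues and series of holomorphic functions\<close>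

text \<open>If the upper limit were not positive it would lie below \<open>c\<close>, and the
  quotient would eventually be below \<open>c\<close>. The condition \<open>g x \<noteq> 0\<close>
  excludes points where the quotient is 0 only by the convention for division.\<close>

lemma omega_limsupI:
  assumes "c > 0" "\<exists>\<^sub>F x in F. norm (f x) \<ge> c * norm (g x) \<and> g x \<noteq> 0"
  shows "omega_limsup F f g"
proof (rule ccontr)
  assume "\<not> omega_limsup F f g"
  then have "Limsup F (\<lambda>x. ereal (norm (f x / g x))) < ereal c"
    using assms(1) unfolding omega_limsup_def by (metis ereal_less(2) not_less order_le_less_trans)
  then have "\<forall>\<^sub>F x in F. ereal (norm (f x / g x)) < ereal c" by (rule Limsup_lessD)
  then have "\<forall>\<^sub>F x in F. \<not> (norm (f x) \<ge> c * norm (g x) \<and> g x \<noteq> 0)"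
    by eventually_elim (auto simp: norm_divide divide_less_eq split: if_splits)
  with assms(2) show False by (simp add: frequently_def)
qed

text \<open>The jump of the partial sums at a frequency is the coefficient, and \<open>R\<close> does not jump.\<close>
lemma omega_limsup_partial_sums:
  fixes R :: "real \<Rightarrow> complex" and g :: "real \<Rightarrow> real"
  assumes lam: "frequency_seq lam"
    and R: "continuous_on {1<..} R" and g: "continuous_on {1<..} g" and gpos: "\<And>x. x > 1 \<Longrightarrow> g x > 0"
    and c: "c > 0" and freq: "\<exists>\<^sub>F n in sequentially. a n \<ge> c * g (lam n)"
  shows "omega_limsup at_top (\<lambda>x. of_real (\<Sum>n | lam n \<le> x. a n) - R x) (\<lambda>x. of_real (g x))"
proof (rule ccontr)
  define P where "P x = (\<Sum>n | lam n \<le> x. a n)" for x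
  assume "\<not> ?thesis"
  then have "\<not> (\<exists>\<^sub>F x in at_top. norm (of_real (P x) - R x) \<ge> c / 4 * norm (of_real (g x) :: complex)
      \<and> (of_real (g x) :: complex) \<noteq> 0)"
    using omega_limsupI[of "c / 4"] c unfolding P_def by force
  then have "\<forall>\<^sub>F x in at_top. norm (of_real (P x) - R x) < c / 4 * \<bar>g x\<bar> \<or> g x = 0"
    unfolding frequently_def not_not by (rule eventually_mono) auto
  then obtain X where X: "\<And>x. x \<ge> X \<Longrightarrow> norm (of_real (P x) - R x) < c / 4 * \<bar>g x\<bar> \<or> g x = 0"
    by (auto simp: eventually_at_top_linorder)
  define Y where "Y = max X 1"
  have Y: "norm (of_real (P x) - R x) \<le> c / 4 * g x" if "x > Y" for x
    using X[of x] gpos[of x] that by (force simp: Y_def)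
  have lam': "strict_mono lam" "filterlim lam at_top sequentially" using lam by (auto simp: frequency_seq_def)
  have P_eq: "P x = (\<Sum>k\<le>n. a k)" if "lam n \<le> x" "x < lam (Suc n)" for x n
  proof -
    have "lam k \<le> x \<longleftrightarrow> k \<le> n" for k
    proof
      assume "lam k \<le> x"
      with that(2) have "lam k < lam (Suc n)" by linarith
      then show "k \<le> n" using strict_mono_less[OF lam'(1)] by simp
    next
      assume "k \<le> n"
      then have "lam k \<le> lam n" using strict_mono_less_eq[OF lam'(1)] by simp
      with that(1) show "lam k \<le> x" by linarith
    qed
    then have "{k. lam k \<le> x} = {..n}" by auto
    then show ?thesis by (simp add: P_def)
  qed
  \<comment> \<open>Every jump beyond \<open>Y\<close> is at most \<open>c / 2 * g\<close>,
    contradicting the frequent lower bound with \<open>c\<close>. The index \<open>Suc n\<close>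
    leaves an interval to the left of the jump that still lies beyond \<open>Y\<close>.\<close>
  have bound: "a (Suc n) \<le> c / 2 * g (lam (Suc n))" if n: "lam n > Y" for n
  proof -
    define x where "x = lam (Suc n)"
    have lt: "lam n < x" using lam'(1) by (simp add: x_def strict_mono_less)
    have x: "x > 1" "x > Y" using lt n by (auto simp: Y_def)
    have Px: "P x = (\<Sum>k\<le>n. a k) + a (Suc n)"
      using P_eq[of "Suc n" x] lam'(1) by (simp add: x_def strict_mono_less)
    have cont: "isCont R x" "isCont g x"
      using R g x(1) by (auto simp: continuous_on_eq_continuous_at)
    \<comment> \<open>The partial sum is constant between \<open>lam n\<close> and \<open>x\<close>,
      so the bound there passes to the left limit by continuity of \<open>R\<close> and
      \<open>g\<close>.\<close>
    have "norm (of_real (\<Sum>k\<le>n. a k) - R x) \<le> c / 4 * g x"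
    proof (rule tendsto_le[of "at_left x"])
      show "((\<lambda>y. norm (of_real (\<Sum>k\<le>n. a k) - R y)) \<longlongrightarrow> norm (of_real (\<Sum>k\<le>n. a k) - R x)) (at_left x)"
        using cont(1) unfolding continuous_at
        by (intro tendsto_intros) (auto intro: tendsto_within_subset)
      show "((\<lambda>y. c / 4 * g y) \<longlongrightarrow> c / 4 * g x) (at_left x)"
        using cont(2) unfolding continuous_at
        by (intro tendsto_intros) (auto intro: tendsto_within_subset)
      have "\<forall>\<^sub>F y in at_left x. y \<in> {lam n<..<x}"
        using lt by (rule eventually_at_left_real)
      then show "\<forall>\<^sub>F y in at_left x. norm (of_real (\<Sum>k\<le>n. a k) - R y) \<le> c / 4 * g y"
      proof eventually_elim
        case (elim y)
        then have "P y = (\<Sum>k\<le>n. a k)" using P_eq[of n y] by (auto simp: x_def)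
        with Y[of y] elim n show ?case by auto
      qed
    qed auto
    moreover have "norm (of_real (P x) - R x) \<le> c / 4 * g x" using Y x by blast
    \<comment> \<open>A positive coefficient is the norm of the jump; a nonpositive one meets the
      bound because \<open>c / 2 * g x\<close> is positive.\<close>
    moreover have "a (Suc n) = norm (of_real (P x) - of_real (\<Sum>k\<le>n. a k) :: complex) \<or> a (Suc n) \<le> 0"
      unfolding Px by (simp add: abs_if)
    moreover have "norm (of_real (P x) - of_real (\<Sum>k\<le>n. a k) :: complex) \<le>
        norm (of_real (P x) - R x) + norm (of_real (\<Sum>k\<le>n. a k) - R x)"
      by (metis norm_triangle_ineq4 diff_diff_eq2 diff_add_cancel add_diff_cancel_right)
    moreover have "c / 2 * g x > 0" using c gpos x by simp
    ultimately show ?thesis unfolding x_def[symmetric] by linarith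
  qed
  have "\<forall>\<^sub>F n in sequentially. lam n > Y" using lam'(2) by (simp add: filterlim_at_top_dense)
  then have "\<forall>\<^sub>F n in sequentially. a (Suc n) < c * g (lam (Suc n))"
  proof eventually_elim
    case (elim n)
    have "lam (Suc n) > 1" using elim lam'(1) by (simp add: Y_def) (smt (verit) lessI strict_mono_less)
    then have "c * g (lam (Suc n)) > 0" using gpos c by simp
    with bound[OF elim] show ?case by linarith
  qed
  then have "\<forall>\<^sub>F n in sequentially. a n < c * g (lam n)"
    by (rule eventually_sequentially_Suc[THEN iffD1])
  with freq show False by (simp add: frequently_def not_le)
qed

section \<open>Residues as functions of \<open>x\<close>, and series of holomorphic
  functions\<close>

lemma higher_deriv_exp_mult: "(deriv ^^ n) (\<lambda>s. exp (s * c)) = (\<lambda>s :: complex. c ^ n * exp (s * c))"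
proof (induction n)
  case (Suc n)
  have "deriv (\<lambda>s. c ^ n * exp (s * c)) s = c ^ Suc n * exp (s * c)" for s
    by (rule DERIV_imp_deriv) (auto intro!: derivative_eq_intros)
  then show ?case by (intro ext) (simp add: Suc)
qed simp

text \<open>The residue is the Taylor coefficient of order \<open>n\<close> of
  \<open>G s * x powr s\<close> at \<open>z0\<close>. The Leibniz rule turns it into a polynomial in
  \<open>ln x\<close> times \<open>exp (z0 * ln x)\<close>, visibly continuous in
  \<open>x\<close>.\<close>

lemma continuous_on_residue_powr:
  assumes U: "open U" "z0 \<in> U" and G: "G holomorphic_on U"
  shows "continuous_on {0<..} (\<lambda>x. residue (\<lambda>s. G s * of_real x powr s / (s - z0) ^ Suc n) z0)"
proof -
  have eq: "residue (\<lambda>s. G s * of_real x powr s / (s - z0) ^ Suc n) z0 =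
      (\<Sum>i=0..n. of_nat (n choose i) * (deriv ^^ i) G z0 *
         (of_real (ln x) ^ (n - i) * exp (z0 * of_real (ln x)))) / fact n" if "x > 0" for x
  proof -
    have e: "of_real x powr s = exp (s * of_real (ln x))" for s :: complex
      using that by (simp add: powr_def Ln_of_real)
    have "residue (\<lambda>s. (G s * exp (s * of_real (ln x))) / (s - z0) ^ Suc n) z0 =
        (deriv ^^ n) (\<lambda>s. G s * exp (s * of_real (ln x))) z0 / fact n"
      by (rule residue_holomorphic_over_power[OF U]) (intro holomorphic_intros G)
    also have "(deriv ^^ n) (\<lambda>s. G s * exp (s * of_real (ln x))) z0 =
        (\<Sum>i=0..n. of_nat (n choose i) * (deriv ^^ i) G z0 *
          (deriv ^^ (n - i)) (\<lambda>s. exp (s * of_real (ln x))) z0)"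
      by (rule higher_deriv_mult[OF G _ U(1,2)]) (intro holomorphic_intros)
    finally show ?thesis by (simp only: e higher_deriv_exp_mult)
  qed
  show ?thesis
    by (subst continuous_on_cong[OF refl eq]) (auto intro!: continuous_intros)
qed

text \<open>Weierstrass test on closed discs, where the weight \<open>g\<close> is bounded by
  compactness. The weight admits majorants that grow with \<open>s\<close>.\<close>

lemma holomorphic_on_suminf:
  fixes f :: "nat \<Rightarrow> complex \<Rightarrow> complex"
  assumes "open U" "\<And>j. f j holomorphic_on U" "summable M" "\<And>j. M j \<ge> 0" "continuous_on U g"
    and "\<And>j s. s \<in> U \<Longrightarrow> norm (f j s) \<le> M j * g s"
  shows "(\<lambda>s. \<Sum>j. f j s) holomorphic_on U"
proof (rule holomorphic_uniform_sequence[OF assms(1), where f = "\<lambda>n s. \<Sum>j<n. f j s"])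
  show "(\<lambda>s. \<Sum>j<n. f j s) holomorphic_on U" for n
    by (intro holomorphic_intros assms)
  fix x assume "x \<in> U"
  then obtain d where d: "d > 0" "cball x d \<subseteq> U"
    using assms(1) open_contains_cball by blast
  have "bounded (g ` cball x d)"
    by (intro compact_imp_bounded compact_continuous_image continuous_on_subset[OF assms(5)] d) auto
  then obtain C where "\<forall>y\<in>g ` cball x d. norm y \<le> C" unfolding bounded_iff by blast
  then have C: "norm (g s) \<le> C" if "s \<in> cball x d" for s using that by blast
  have "uniform_limit (cball x d) (\<lambda>n s. \<Sum>j<n. f j s) (\<lambda>s. \<Sum>j. f j s) sequentially"
  proof (rule Weierstrass_m_test)
    show "summable (\<lambda>j. M j * C)" by (rule summable_mult2) fact
    fix j s assume s: "s \<in> cball x d"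
    then have "norm (f j s) \<le> M j * g s" using assms(6) d(2) by blast
    also have "\<dots> \<le> M j * C" using C[OF s] assms(4) by (intro mult_left_mono) auto
    finally show "norm (f j s) \<le> M j * C" .
  qed
  with d show "\<exists>d>0. cball x d \<subseteq> U \<and> uniform_limit (cball x d) (\<lambda>n s. \<Sum>j<n. f j s) (\<lambda>s. \<Sum>j. f j s) sequentially"
    by blast
qed

subsection \<open>The construction\<close>

lemma summable_power_mult_exp_neg:
  fixes c :: real
  assumes "c > 0"
  shows "summable (\<lambda>j. real j ^ r * exp (- c * real j))"
proof (rule summable_comparison_test_bigo)
  show "summable (\<lambda>j. norm (1 / real j ^ 2))"
    using inverse_power_summable[of 2] by (simp add: field_simps)
  show "(\<lambda>j. real j ^ r * exp (- c * real j)) \<in> O(\<lambda>j. 1 / real j ^ 2)"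
    using assms by real_asymp
qed

locale spiked_series =
  fixes \<alpha> \<delta> \<kappa> :: real and r :: nat
  assumes \<delta>_pos: "0 < \<delta>" and \<delta>_less: "\<delta> < \<alpha>" and \<kappa>_gt: "1 / 2 < \<kappa>"
begin

definition "\<theta> = \<delta> / (\<kappa> + 1 / 2)"
text \<open>Larger than \<delta>, so that the open half-plane \<open>U\<close> contains the closed
  one of the hypothesis. The cap \<theta>/4 preserves decay of the spikes; the cap \<alpha> -
  \<delta> keeps \<open>Re s\<close> positive on \<open>U\<close>.\<close>

definition "b = \<delta> + min (\<theta> / 4) (\<alpha> - \<delta>)"
definition "K = nat \<lceil>\<kappa>\<rceil>"
definition "B j = real (Suc j) ^ r * exp (b * real (Suc j))"
text \<open>The factor \<open>4 ^ j * (B j)\<^sup>2\<close> makes the Riemann sum errors summable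
  over \<open>j\<close>; \<open>Suc K\<close> offsets the denominator of \<open>h\<close>, so that
  \<open>h j * N j \<ge> 1\<close>.\<close>

definition "N j = nat \<lceil>real (Suc K) * 4 ^ j * (B j)\<^sup>2\<rceil>"
text \<open>The division by \<open>Suc K\<close> keeps the spike, of length at most
  \<open>K * h j\<close>, inside its own block.\<close>

definition "h j = exp (- \<theta> * real j) / real (Suc K)"
definition "L j = nat \<lfloor>h j * real (N j)\<rfloor>"
definition "f u = u ^ r * exp (\<alpha> * u)"
text \<open>Chosen so that \<open>height j * (2 ^ K / L j) = f j / N j\<close>: the coefficient
  bound of the spike is exactly matched by the density at the start of the block.\<close>

definition "height j = f (real j) * (real (L j) / real (N j)) / 2 ^ K"
definition "coef j i = f (real j + real i / real (N j)) / real (N j) + height j * coeff (spike_poly (L j) K) i"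

definition "riem j s = (\<Sum>i<N j. of_real (real j + real i / real (N j)) ^ r
   * exp (- (s - of_real \<alpha>) * of_real (real j + real i / real (N j))) / of_nat (N j))"
definition "err j s = riem j s - (power_exp_antideriv r (s - of_real \<alpha>) (of_nat (Suc j))
   - power_exp_antideriv r (s - of_real \<alpha>) (of_nat j))"
definition "spike j s = of_real (height j) * exp (- s * of_nat j)
   * (1 - (\<Sum>l=1..L j. exp (- s * of_real (1 / real (N j))) ^ l) / of_nat (L j)) ^ K"
definition "H s = (\<Sum>j. err j s + spike j s)"
text \<open>The first term is the transform of the undiscretised measure; \<open>H\<close> collects
  the discretisation errors and the spikes.\<close>

definition "A s = fact r / (s - of_real \<alpha>) ^ Suc r + H s"
definition "U = {s. Re s > \<alpha> - b}"

section \<open>Inequalities between the parameters\<close>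

lemma \<alpha>_pos: "\<alpha> > 0" and \<kappa>_pos: "\<kappa> > 0"
  using \<delta>_pos \<delta>_less \<kappa>_gt by linarith+

lemma \<theta>_pos: "\<theta> > 0"
  using \<delta>_pos \<kappa>_gt by (simp add: \<theta>_def)

text \<open>Equivalently \<delta> - \<theta> * (1 + \<kappa>) = - \<theta> / 2, the decay rate of
  the spikes on the line \<open>Re s\<close> = \<alpha> - \<delta>.\<close>

lemma \<delta>_eq: "\<delta> = \<theta> * \<kappa> + \<theta> / 2"
proof -
  have "\<theta> * (\<kappa> + 1 / 2) = \<delta>" using \<kappa>_gt by (simp add: \<theta>_def)
  then show ?thesis by (simp add: distrib_left)
qed

lemma \<theta>_le: "\<theta> \<le> \<delta>"
  using \<delta>_pos \<kappa>_gt by (simp add: \<theta>_def field_simps)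

lemma b_bounds: "\<delta> < b" "b \<le> \<delta> + \<theta> / 4" "b \<le> \<alpha>" "0 < b"
  using \<delta>_pos \<delta>_less \<theta>_pos by (auto simp: b_def min_def)

lemma \<kappa>_le_K: "\<kappa> \<le> real K"
  using \<kappa>_pos by (simp add: K_def)

lemma B_ge: "B j \<ge> exp (\<theta> * real j)" and B_ge_1: "B j \<ge> 1"
proof -
  have "\<theta> * real j \<le> b * real (Suc j)"
    using \<theta>_le b_bounds \<theta>_pos by (intro mult_mono) auto
  then have "1 * exp (\<theta> * real j) \<le> B j"
    unfolding B_def by (intro mult_mono) auto
  then show "B j \<ge> exp (\<theta> * real j)" by simp
  moreover have "exp (\<theta> * real j) \<ge> 1" using \<theta>_pos by simp
  ultimately show "B j \<ge> 1" by linarith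
qed

lemma N_ge: "real (N j) \<ge> real (Suc K) * 4 ^ j * (B j)\<^sup>2"
  unfolding N_def by linarith

lemma N_ge': "real (N j) \<ge> 4 ^ j * (B j)\<^sup>2"
proof -
  have "4 ^ j * (B j)\<^sup>2 = 1 * (4 ^ j * (B j)\<^sup>2)" by simp
  also have "\<dots> \<le> real (Suc K) * (4 ^ j * (B j)\<^sup>2)"
    by (intro mult_right_mono) auto
  also have "\<dots> \<le> real (N j)" using N_ge[of j] by (simp only: mult.assoc)
  finally show ?thesis .
qed

lemma N_pos: "N j \<ge> 1"
proof -
  have "1 * 1 \<le> 4 ^ j * (B j)\<^sup>2" using B_ge_1[of j] by (intro mult_mono) auto
  then show ?thesis using N_ge'[of j] by simp
qed

lemma h_N_ge: "h j * real (N j) \<ge> 1"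
proof -
  have "1 = exp (- \<theta> * real j) * (1 * exp (\<theta> * real j))" by (simp flip: exp_add)
  also have "\<dots> \<le> exp (- \<theta> * real j) * (4 ^ j * (B j)\<^sup>2)"
  proof (intro mult_left_mono mult_mono)
    show "exp (\<theta> * real j) \<le> (B j)\<^sup>2"
      using B_ge[of j] self_le_power[OF B_ge_1, of 2 j] by simp
  qed auto
  also have "\<dots> = h j * (real (Suc K) * 4 ^ j * (B j)\<^sup>2)"
    by (simp add: h_def field_simps)
  also have "\<dots> \<le> h j * real (N j)"
    by (intro mult_left_mono N_ge) (simp add: h_def)
  finally show ?thesis .
qed

lemma L_ge_1: "L j \<ge> 1" and L_le: "real (L j) \<le> h j * real (N j)" and L_ge: "real (L j) \<ge> h j * real (N j) / 2"
proof -
  \<comment> \<open>The floor of a real number that is at least 1 is at least half of it.\<close>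
  have "\<lfloor>h j * real (N j)\<rfloor> \<ge> 1" using h_N_ge[of j] by simp
  moreover from this have "real (L j) = of_int \<lfloor>h j * real (N j)\<rfloor>" by (simp add: L_def)
  ultimately show "L j \<ge> 1" "real (L j) \<le> h j * real (N j)" "real (L j) \<ge> h j * real (N j) / 2"
    by linarith+
qed

lemma h_le: "h j \<le> exp (- \<theta> * real j)"
  by (simp add: h_def field_simps)

lemma L_div_N: "real (L j) / real (N j) \<le> h j" "real (L j) / real (N j) \<ge> h j / 2"
  using L_le[of j] L_ge[of j] N_pos[of j] by (simp_all add: field_simps)

text \<open>From \<open>Suc K * L j \<le> N j\<close> and \<open>L j \<ge> 1\<close>. The support of
  the spike thus ends before the next block.\<close>

lemma K_L_less: "K * L j < N j"
proof -
  have "real (Suc K) * real (L j) \<le> exp (- \<theta> * real j) * real (N j)"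
    using L_le[of j] by (simp add: h_def field_simps)
  also have "\<dots> \<le> 1 * real (N j)"
    using \<theta>_pos by (intro mult_right_mono) auto
  finally have "Suc K * L j \<le> N j" by (metis mult_1 of_nat_le_iff of_nat_mult)
  then show ?thesis using L_ge_1[of j] by simp
qed

section \<open>Non-negativity and size of the coefficients\<close>

lemma f_mono: "0 \<le> u \<Longrightarrow> u \<le> v \<Longrightarrow> f u \<le> f v"
  unfolding f_def using \<alpha>_pos by (intro mult_mono power_mono) auto

lemma f_nonneg: "0 \<le> u \<Longrightarrow> f u \<ge> 0"
  by (simp add: f_def)

lemma height_nonneg: "height j \<ge> 0"
  by (simp add: height_def f_nonneg)

text \<open>At offset 0 both summands are non-negative. At later offsets the spike subtracts at most
  \<open>f j / N j\<close> by the choice of \<open>height\<close>, and \<open>f\<close> is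
  nondecreasing.\<close>

lemma coef_nonneg: "coef j i \<ge> 0"
proof (cases "i = 0")
  case True
  then show ?thesis by (simp add: coef_def f_nonneg height_nonneg coeff_spike_poly_0)
next
  case False
  then have "- (2 ^ K / real (L j)) \<le> coeff (spike_poly (L j) K) i"
    using coeff_spike_poly_le[OF L_ge_1, of i j K] by (simp add: abs_le_iff)
  then have "height j * - (2 ^ K / real (L j)) \<le> height j * coeff (spike_poly (L j) K) i"
    by (intro mult_left_mono height_nonneg)
  moreover have "height j * (2 ^ K / real (L j)) = f (real j) / real (N j)"
    using L_ge_1[of j] by (simp add: height_def)
  moreover have "f (real j) / real (N j) \<le> f (real j + real i / real (N j)) / real (N j)"
    by (intro divide_right_mono f_mono) auto
  ultimately show ?thesis by (simp add: coef_def)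
qed

text \<open>The full mass \<open>height j\<close> sits at offset 0, and
  \<open>L j / N j \<ge> h j / 2\<close>.\<close>

lemma coef_0_ge: "coef j 0 \<ge> 1 / (2 ^ Suc K * real (Suc K)) * (real j ^ r * exp ((\<alpha> - \<theta>) * real j))"
proof -
  have "1 / (2 ^ Suc K * real (Suc K)) * (real j ^ r * exp ((\<alpha> - \<theta>) * real j)) = f (real j) * (h j / 2) / 2 ^ K"
    by (simp add: f_def h_def field_simps flip: exp_add)
  also have "\<dots> \<le> height j"
    unfolding height_def by (intro divide_right_mono mult_left_mono L_div_N f_nonneg) auto
  also have "\<dots> \<le> coef j 0"
    by (simp add: coef_def coeff_spike_poly_0 f_nonneg)
  finally show ?thesis .
qed

text \<open>On the grid of step \<open>1 / N j\<close> the exponentials are powers of a single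
  \<open>z\<close>, so the spike part is \<open>spike_poly\<close> evaluated at
  \<open>z\<close>.\<close>

lemma block_sum:
  fixes s :: complex
  shows "(\<Sum>i<N j. of_real (coef j i) * exp (- s * of_real (real j + real i / real (N j)))) = riem j s + spike j s"
proof -
  let ?p = "\<lambda>i. real j + real i / real (N j)"
  let ?z = "exp (- s * of_real (1 / real (N j)))"
  have 1: "of_real (f (?p i)) * exp (- s * of_real (?p i)) =
      of_real (?p i) ^ r * exp (- (s - of_real \<alpha>) * of_real (?p i))" for i
  proof -
    have "complex_of_real (\<alpha> * p) + - s * of_real p = - (s - of_real \<alpha>) * of_real p" for p
      by (simp add: algebra_simps)
    then have "exp (of_real (\<alpha> * ?p i)) * exp (- s * of_real (?p i)) = exp (- (s - of_real \<alpha>) * of_real (?p i))"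
      by (simp only: exp_add[symmetric])
    then show ?thesis
      by (simp only: f_def of_real_mult of_real_power mult.assoc exp_of_real[symmetric])
  qed
  have 2: "exp (- s * of_real (?p i)) = exp (- s * of_nat j) * ?z ^ i" for i
    by (simp add: algebra_simps flip: exp_of_nat_mult exp_add)
  have "(\<Sum>i<N j. of_real (coef j i) * exp (- s * of_real (?p i))) =
     (\<Sum>i<N j. of_real (f (?p i)) * exp (- s * of_real (?p i)) / of_nat (N j)) +
     (\<Sum>i<N j. of_real (height j) * (of_real (coeff (spike_poly (L j) K) i) * exp (- s * of_real (?p i))))"
    unfolding coef_def by (simp add: ring_distribs sum.distrib mult.assoc)
  also have "(\<Sum>i<N j. of_real (f (?p i)) * exp (- s * of_real (?p i)) / of_nat (N j)) = riem j s"
    by (simp only: 1 riem_def)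
  also have "(\<Sum>i<N j. of_real (height j) * (of_real (coeff (spike_poly (L j) K) i) * exp (- s * of_real (?p i)))) =
      of_real (height j) * exp (- s * of_nat j) * (\<Sum>i<N j. of_real (coeff (spike_poly (L j) K) i) * ?z ^ i)"
    unfolding 2 sum_distrib_left by (simp only: mult_ac)
  also have "\<dots> = spike j s"
    unfolding spike_def by (subst sum_coeff_spike_poly[OF K_L_less]) simp
  finally show ?thesis .
qed

lemma norm_err_le:
  assumes "s \<in> U - {of_real \<alpha>}"
  shows "norm (err j s) \<le> 2 * (r + \<alpha> + 1) * (1 / 2) ^ j * (1 + norm s) powr \<kappa>"
proof (rule power2_le_imp_le)
  define w where "w = s - of_real \<alpha>"
  define W where "W = real r + norm w"
  have w: "w \<noteq> 0" "Re w \<ge> - b" using assms by (auto simp: w_def U_def)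
  note E = riemann_sum_power_exp_error[OF w less_imp_le[OF b_bounds(4)] N_pos, where n = r and j = j]
  have e: "norm (err j s) \<le> 2 * B j" "norm (err j s) \<le> W * B j / real (N j)"
    using E[of j] unfolding err_def riem_def B_def w_def W_def by (simp_all add: mult.assoc)
  \<comment> \<open>The two error bounds are multiplied, so that only the square root of
    \<open>W\<close> enters.\<close>
  have "(norm (err j s))\<^sup>2 \<le> 2 * B j * (W * B j / real (N j))"
    unfolding power2_eq_square using B_ge_1[of j] by (intro mult_mono e) auto
  also have "\<dots> = 2 * W * ((B j)\<^sup>2 / real (N j))" by (simp add: power2_eq_square)
  also have "\<dots> \<le> 2 * W * (1 / 4 ^ j)"
  proof (rule mult_left_mono)
    show "(B j)\<^sup>2 / real (N j) \<le> 1 / 4 ^ j"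
      using N_ge'[of j] N_pos[of j] by (simp add: field_simps)
  qed (simp add: W_def)
  finally have 1: "(norm (err j s))\<^sup>2 \<le> 2 * W * (1 / 4 ^ j)" .
  define q where "q = real r + \<alpha> + 1"
  define Y where "Y = 1 + norm s"
  have Y: "Y \<ge> 1" and q: "q \<ge> 1" using \<alpha>_pos by (simp_all add: Y_def q_def)
  have "norm w \<le> norm s + \<alpha>" unfolding w_def using norm_triangle_ineq4[of s "of_real \<alpha>"] \<alpha>_pos by simp
  then have "W \<le> q + norm s" by (simp add: W_def q_def)
  also have "\<dots> \<le> q * Y" using mult_right_mono[OF q norm_ge_zero[of s]] by (simp add: Y_def algebra_simps)
  finally have 2: "W \<le> q * Y" .
  \<comment> \<open>Here \<open>1 / 2 < \<kappa>\<close> enters: the square root of \<open>Y\<close>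
    is absorbed by \<open>Y powr \<kappa>\<close>.\<close>
  have 3: "Y \<le> (Y powr \<kappa>)\<^sup>2"
  proof -
    have "Y powr 1 \<le> Y powr (2 * \<kappa>)" using Y \<kappa>_gt by (intro powr_mono) auto
    also have "\<dots> = (Y powr \<kappa>)\<^sup>2" by (simp add: power2_eq_square flip: powr_add)
    finally show ?thesis using Y by simp
  qed
  have "2 * W \<le> 2 * (q * (Y powr \<kappa>)\<^sup>2)"
    using 2 mult_left_mono[OF 3, of q] q by linarith
  \<comment> \<open>Giving away the factor \<open>2 * q \<ge> 1\<close> makes the bound a perfect
    square.\<close>
  also have "\<dots> \<le> 4 * (q * q * (Y powr \<kappa>)\<^sup>2)"
  proof -
    have "1 * (q * (Y powr \<kappa>)\<^sup>2) \<le> 2 * q * (q * (Y powr \<kappa>)\<^sup>2)"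
      using q by (intro mult_right_mono) auto
    then show ?thesis by simp
  qed
  finally have "2 * W * (1 / 4 ^ j) \<le> 4 * (q * q * (Y powr \<kappa>)\<^sup>2) * (1 / 4 ^ j)"
    by (intro mult_right_mono) auto
  also have "\<dots> = (2 * q * (1 / 2) ^ j * Y powr \<kappa>)\<^sup>2"
    by (simp add: power_mult_distrib power2_eq_square power_divide flip: power_mult_distrib)
  finally show "(norm (err j s))\<^sup>2 \<le> (2 * (r + \<alpha> + 1) * (1 / 2) ^ j * (1 + norm s) powr \<kappa>)\<^sup>2"
    using 1 unfolding q_def Y_def by linarith
qed (use \<alpha>_pos in auto)

lemma norm_spike_le:
  assumes "s \<in> U"
  shows "norm (spike j s) \<le> real j ^ r * exp (- (\<theta> / 4) * real j) * norm s powr \<kappa>"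
proof -
  have Re: "Re s \<ge> 0" "\<alpha> - Re s \<le> b" using assms b_bounds by (auto simp: U_def)
  define \<Phi> where "\<Phi> = 1 - (\<Sum>l=1..L j. exp (- s * of_real (1 / real (N j))) ^ l) / of_nat (L j)"
  define q where "q = real (L j) / real (N j)"
  have q: "0 \<le> q" "q \<le> h j" using L_div_N by (auto simp: q_def)
  have "norm \<Phi> \<le> min 2 (norm s * q)"
    unfolding \<Phi>_def q_def using norm_spike_factor_le[OF Re(1) L_ge_1, of "1 / real (N j)" j] by simp
  then have "norm \<Phi> ^ K \<le> min 2 (norm s * q) ^ K" by (intro power_mono) auto
  also have "\<dots> \<le> 2 ^ K * (norm s * q) powr \<kappa>"
    using q \<kappa>_pos \<kappa>_le_K by (intro min_two_power_le) auto
  finally have \<Phi>: "norm \<Phi> ^ K \<le> 2 ^ K * (norm s powr \<kappa> * q powr \<kappa>)"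
    using q by (simp add: powr_mult)
  \<comment> \<open>One factor \<open>q\<close> comes from \<open>height\<close>, the power
    \<open>q powr \<kappa>\<close> from the vanishing moments.\<close>
  have q\<kappa>: "q * q powr \<kappa> \<le> exp (- \<theta> * (1 + \<kappa>) * real j)"
  proof -
    have "q * q powr \<kappa> = q powr (1 + \<kappa>)" using q by (cases "q = 0") (simp_all add: powr_add)
    also have "\<dots> \<le> exp (- \<theta> * real j) powr (1 + \<kappa>)"
      using q h_le[of j] \<kappa>_pos by (intro powr_mono2) auto
    also have "\<dots> = exp (- \<theta> * (1 + \<kappa>) * real j)" by (simp add: powr_def algebra_simps)
    finally show ?thesis .
  qed
  have "norm (spike j s) = height j * exp (- Re s * real j) * norm \<Phi> ^ K"
    unfolding spike_def \<Phi>_def[symmetric] using height_nonneg[of j] by (simp add: norm_mult norm_power)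
  also have "\<dots> \<le> height j * exp (- Re s * real j) * (2 ^ K * (norm s powr \<kappa> * q powr \<kappa>))"
    by (intro mult_left_mono \<Phi>) (simp add: height_nonneg)
  also have "\<dots> = real j ^ r * (exp (\<alpha> * real j) * exp (- Re s * real j)) * (q * q powr \<kappa>) * norm s powr \<kappa>"
    unfolding height_def f_def q_def[symmetric] by simp
  also have "exp (\<alpha> * real j) * exp (- Re s * real j) = exp ((\<alpha> - Re s) * real j)"
    by (simp add: left_diff_distrib flip: exp_add)
  also have "real j ^ r * exp ((\<alpha> - Re s) * real j) * (q * q powr \<kappa>) * norm s powr \<kappa>
      \<le> real j ^ r * exp (b * real j) * exp (- \<theta> * (1 + \<kappa>) * real j) * norm s powr \<kappa>"
    using Re q q\<kappa> by (intro mult_right_mono mult_mono) (auto intro!: mult_right_mono)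
  also have "\<dots> = real j ^ r * exp ((b - \<theta> * (1 + \<kappa>)) * real j) * norm s powr \<kappa>"
    by (simp add: algebra_simps flip: exp_add)
  also have "\<dots> \<le> real j ^ r * exp (- (\<theta> / 4) * real j) * norm s powr \<kappa>"
  proof (intro mult_right_mono mult_left_mono)
    \<comment> \<open>The left side is at most \<theta>/4 + \<delta> - \<theta> * (1 + \<kappa>) =
      \<theta>/4 - \<theta>/2.\<close>
    have "b - \<theta> * (1 + \<kappa>) \<le> - (\<theta> / 4)" using b_bounds(2) \<delta>_eq by (simp add: algebra_simps)
    then have "(b - \<theta> * (1 + \<kappa>)) * real j \<le> - (\<theta> / 4) * real j" by (intro mult_right_mono) auto
    then show "exp ((b - \<theta> * (1 + \<kappa>)) * real j) \<le> exp (- (\<theta> / 4) * real j)" by simp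
  qed auto
  finally show ?thesis .
qed

definition "M j = 2 * (r + \<alpha> + 1) * (1 / 2) ^ j + real j ^ r * exp (- (\<theta> / 4) * real j)"

lemma M_nonneg: "M j \<ge> 0"
  using \<alpha>_pos by (simp add: M_def)

lemma summable_M: "summable M"
  unfolding M_def using \<theta>_pos
  by (intro summable_add summable_mult summable_geometric summable_power_mult_exp_neg) auto

lemma norm_err_spike_le:
  assumes "s \<in> U - {of_real \<alpha>}"
  shows "norm (err j s + spike j s) \<le> M j * (1 + norm s) powr \<kappa>"
proof -
  have "norm (spike j s) \<le> real j ^ r * exp (- (\<theta> / 4) * real j) * norm s powr \<kappa>"
    using assms by (intro norm_spike_le) auto
  also have "\<dots> \<le> real j ^ r * exp (- (\<theta> / 4) * real j) * (1 + norm s) powr \<kappa>"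
    using \<kappa>_pos by (intro mult_left_mono powr_mono2) auto
  finally show ?thesis
    using norm_err_le[OF assms, of j] norm_triangle_ineq[of "err j s" "spike j s"]
    by (simp add: M_def distrib_right)
qed

section \<open>Convergence, growth and holomorphy of the remainder \<open>H\<close>\<close>

lemma summable_err_spike: "s \<in> U - {of_real \<alpha>} \<Longrightarrow> summable (\<lambda>j. err j s + spike j s)"
  by (rule summable_comparison_test'[OF summable_mult2[OF summable_M]]) (rule norm_err_spike_le)

lemma norm_H_le: "s \<in> U - {of_real \<alpha>} \<Longrightarrow> norm (H s) \<le> suminf M * (1 + norm s) powr \<kappa>"
  unfolding H_def suminf_mult2[OF summable_M]
  by (rule norm_suminf_le[OF norm_err_spike_le summable_mult2[OF summable_M]])

lemma suminf_M_nonneg: "suminf M \<ge> 0"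
  by (rule suminf_nonneg[OF summable_M M_nonneg])

lemma open_U: "open U"
  unfolding U_def by (rule open_halfspace_Re_gt)

lemma \<alpha>_in_U: "of_real \<alpha> \<in> U"
  using b_bounds by (simp add: U_def)

text \<open>Weierstrass test with weight \<open>(1 + norm s) powr \<kappa>\<close>. The point
  \<alpha> is removed because the closed formula for the antiderivative divides by
  \<open>s - \<alpha>\<close>.\<close>

lemma H_holomorphic: "H holomorphic_on U - {of_real \<alpha>}"
  unfolding H_def
proof (rule holomorphic_on_suminf[OF _ _ summable_M M_nonneg])
  show "open (U - {of_real \<alpha>})" using open_U by (intro open_delete)
  show "continuous_on (U - {of_real \<alpha>}) (\<lambda>s. (1 + norm s) powr \<kappa>)"
    by (intro continuous_intros) (auto simp: add_nonneg_eq_0_iff)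
  show "norm (err j s + spike j s) \<le> M j * (1 + norm s) powr \<kappa>" if "s \<in> U - {of_real \<alpha>}" for j s
    by (rule norm_err_spike_le[OF that])
  fix j
  have "(\<lambda>s. power_exp_antideriv r (s - of_real \<alpha>) u) holomorphic_on (U - {of_real \<alpha>})" for u
  proof -
    have "((\<lambda>w. power_exp_antideriv r w u) \<circ> (\<lambda>s. s - of_real \<alpha>)) holomorphic_on (U - {of_real \<alpha>})"
      by (rule holomorphic_on_compose_gen[where t = "- {0}"])
         (auto intro!: holomorphic_intros holomorphic_power_exp_antideriv)
    then show ?thesis by (simp add: o_def)
  qed
  then have "err j holomorphic_on (U - {of_real \<alpha>})"
    unfolding err_def[abs_def] riem_def using N_pos[of j] by (intro holomorphic_intros) auto
  moreover have "spike j holomorphic_on (U - {of_real \<alpha>})"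
    unfolding spike_def[abs_def] using L_ge_1[of j] by (intro holomorphic_intros) auto
  ultimately show "(\<lambda>s. err j s + spike j s) holomorphic_on (U - {of_real \<alpha>})"
    by (intro holomorphic_intros)
qed

section \<open>The Dirichlet series and its pole\<close>

definition "lam n = exp (block_point N n)"
definition "a n = coef (block_index N n) (block_offset N n)"

lemma frequency_seq_lam: "frequency_seq lam"
  unfolding lam_def[abs_def] by (rule frequency_seq_exp_block_point) (rule N_pos)

lemma a_nonneg: "a n \<ge> 0"
  by (simp add: a_def coef_nonneg)

text \<open>The block integrals telescope to \<open>Q J - Q 0\<close>. For
  \<open>Re t > \<alpha>\<close> the first term tends to 0, and \<open>- Q 0\<close> is the pole
  term of \<open>A\<close>.\<close>

lemma a_sums:
  assumes "Re s > \<alpha>"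
  shows "(\<lambda>n. of_real (a n) * of_real (lam n) powr (- s)) sums A s"
  unfolding a_def lam_def
proof (rule sums_of_block_sums[of N])
  fix t :: complex assume "Re t = Re s"
  with assms have t: "Re t > \<alpha>" by simp
  then have t': "t \<noteq> of_real \<alpha>" "t \<in> U - {of_real \<alpha>}" using b_bounds by (auto simp: U_def)
  define Q where "Q = power_exp_antideriv r (t - of_real \<alpha>)"
  have "(\<lambda>J. \<Sum>j<J. err j t + spike j t) \<longlonglongrightarrow> H t"
    unfolding H_def using summable_LIMSEQ[OF summable_err_spike[OF t'(2)]] .
  moreover have "(\<lambda>J. Q (of_nat J)) \<longlonglongrightarrow> 0"
    unfolding Q_def using t by (intro tendsto_power_exp_antideriv) simp
  ultimately have "(\<lambda>J. (\<Sum>j<J. err j t + spike j t) + (Q (of_nat J) - Q (of_nat 0))) \<longlonglongrightarrow> H t + (0 - Q (of_nat 0))"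
    by (intro tendsto_intros)
  moreover have "H t + (0 - Q (of_nat 0)) = A t"
    using t' by (simp add: A_def Q_def power_exp_antideriv_0 del: power_Suc)
  moreover have "(\<Sum>j<J. \<Sum>i<N j. of_real (coef j i) * exp (- t * of_real (real j + real i / real (N j)))) =
      (\<Sum>j<J. err j t + spike j t) + (Q (of_nat J) - Q (of_nat 0))" for J
  proof -
    have "(\<Sum>j<J. riem j t + spike j t) = (\<Sum>j<J. (err j t + spike j t) + (Q (of_nat (Suc j)) - Q (of_nat j)))"
      by (simp add: err_def Q_def)
    also have "\<dots> = (\<Sum>j<J. err j t + spike j t) + (Q (of_nat J) - Q (of_nat 0))"
      by (simp only: sum.distrib sum_lessThan_telescope[of "\<lambda>j. Q (of_nat j)"])
    finally show ?thesis by (simp only: block_sum)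
  qed
  ultimately show "(\<lambda>J. \<Sum>j<J. \<Sum>i<N j. of_real (coef j i) * exp (- t * of_real (real j + real i / real (N j)))) \<longlonglongrightarrow> A t"
    by simp
qed (use N_pos coef_nonneg in auto)

text \<open>\<open>(s - \<alpha>) ^ Suc r * A s\<close> away from \<alpha>, written without division
  so that its value at \<alpha> is the right one whatever \<open>H\<close> is there.\<close>

definition "g s = fact r + (s - of_real \<alpha>) ^ Suc r * H s"

lemma A_eq: "s \<noteq> of_real \<alpha> \<Longrightarrow> A s = g s / (s - of_real \<alpha>) ^ Suc r"
  by (simp add: A_def g_def add_divide_distrib del: power_Suc)

lemma g_\<alpha>: "g (of_real \<alpha>) = fact r"
  by (simp add: g_def)

text \<open>\<open>H\<close> is bounded near \<alpha>, so
  \<open>(s - \<alpha>) ^ Suc r * H s\<close> tends to 0. Thus \<open>g\<close> is continuous at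
  \<alpha> and the singularity is removable.\<close>

lemma g_holomorphic: "g holomorphic_on U"
proof (rule no_isolated_singularity[where K = "{of_real \<alpha>}"])
  show hol: "g holomorphic_on U - {of_real \<alpha>}"
    unfolding g_def[abs_def] by (intro holomorphic_intros H_holomorphic)
  have "isCont g s" if "s \<in> U" for s
  proof (cases "s = of_real \<alpha>")
    case False
    then show ?thesis
      using that holomorphic_on_imp_continuous_on[OF hol] open_U
      by (simp add: continuous_on_eq_continuous_at open_delete)
  next
    case s: True
    have "\<forall>\<^sub>F z in at s. z \<in> U - {of_real \<alpha>}"
      unfolding s by (rule eventually_at_in_open[OF open_U \<alpha>_in_U])
    then have ev: "\<forall>\<^sub>F z in at s. norm ((z - of_real \<alpha>) ^ Suc r * H z) \<le>
        norm (z - of_real \<alpha>) ^ Suc r * (suminf M * (1 + norm z) powr \<kappa>)"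
    proof eventually_elim
      case (elim z)
      show ?case
        unfolding norm_mult[of "(z - of_real \<alpha>) ^ Suc r"] norm_power
        by (rule mult_left_mono[OF norm_H_le[OF elim]]) simp
    qed
    have "1 + norm s \<noteq> 0" using norm_ge_zero[of s] by linarith
    then have "((\<lambda>z. norm (z - of_real \<alpha>) ^ Suc r * (suminf M * (1 + norm z) powr \<kappa>)) \<longlongrightarrow>
        norm (s - of_real \<alpha>) ^ Suc r * (suminf M * (1 + norm s) powr \<kappa>)) (at s)"
      by (intro tendsto_intros disjI1)
    then have "((\<lambda>z. norm (z - of_real \<alpha>) ^ Suc r * (suminf M * (1 + norm z) powr \<kappa>)) \<longlongrightarrow> 0) (at s)"
      unfolding s by simp
    with ev have "((\<lambda>z. (z - of_real \<alpha>) ^ Suc r * H z) \<longlongrightarrow> 0) (at s)"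
      by (rule Lim_null_comparison)
    from tendsto_add[OF tendsto_const[of "fact r"] this]
    have "(g \<longlongrightarrow> fact r) (at s)" unfolding g_def[abs_def] by (simp only: add_0_right)
    then show ?thesis unfolding continuous_at s g_\<alpha> .
  qed
  then show "continuous_on U g" by (intro continuous_at_imp_continuous_on ballI)
qed (simp_all add: open_U)

lemma A_zorder: "zorder A (of_real \<alpha>) = - int (Suc r)"
proof (rule zorder_eqI[OF open_U \<alpha>_in_U g_holomorphic])
  show "g (of_real \<alpha>) \<noteq> 0" by (simp add: g_\<alpha>)
  show "A w = g w * (w - of_real \<alpha>) powi - int (Suc r)" if "w \<noteq> of_real \<alpha>" for w
    by (simp only: A_eq[OF that] power_int_minus power_int_of_nat divide_inverse)
qed

lemma A_pole: "is_pole A (of_real \<alpha>)"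
proof (rule is_pole_transform)
  show "is_pole (\<lambda>s. g s / (s - of_real \<alpha>) ^ Suc r) (of_real \<alpha>)"
  proof (rule is_pole_divide)
    show "isCont g (of_real \<alpha>)"
      using holomorphic_on_imp_continuous_on[OF g_holomorphic] continuous_on_eq_continuous_at[OF open_U] \<alpha>_in_U
      by blast
    show "filterlim (\<lambda>s. (s - of_real \<alpha>) ^ Suc r) (at 0) (at (complex_of_real \<alpha>))"
      unfolding filterlim_at
    proof
      show "\<forall>\<^sub>F s in at (complex_of_real \<alpha>). (s - of_real \<alpha>) ^ Suc r \<in> UNIV \<and> (s - of_real \<alpha>) ^ Suc r \<noteq> 0"
        by (auto simp: eventually_at_filter)
      have "((\<lambda>s. (s - of_real \<alpha>) ^ Suc r) \<longlongrightarrow> (complex_of_real \<alpha> - of_real \<alpha>) ^ Suc r) (at (of_real \<alpha>))"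
        by (intro tendsto_intros)
      then show "((\<lambda>s. (s - of_real \<alpha>) ^ Suc r) \<longlongrightarrow> 0) (at (complex_of_real \<alpha>))" by simp
    qed
  qed (simp add: g_\<alpha>)
  show "\<forall>\<^sub>F s in at (of_real \<alpha>). g s / (s - of_real \<alpha>) ^ Suc r = A s"
    by (auto simp: eventually_at_filter A_eq)
qed simp

lemma A_analytic: "A analytic_on {s. Re s \<ge> \<alpha> - \<delta>} - {of_real \<alpha>}"
proof (rule analytic_on_subset)
  have "A holomorphic_on U - {of_real \<alpha>}"
    unfolding A_def[abs_def] by (intro holomorphic_intros H_holomorphic) auto
  then show "A analytic_on U - {of_real \<alpha>}"
    using open_U by (simp add: analytic_on_open open_delete)
  show "{s. Re s \<ge> \<alpha> - \<delta>} - {of_real \<alpha>} \<subseteq> U - {of_real \<alpha>}"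
    using b_bounds by (auto simp: U_def)
qed

section \<open>Growth in the strip and on its left edge\<close>

lemma norm_plus_le: "1 + (norm s + \<alpha>) \<le> (1 + \<alpha>) * (1 + norm s)"
  using \<alpha>_pos by (simp add: algebra_simps)

lemma A_strip_bound:
  "\<exists>M\<^sub>1 M\<^sub>2::real. M\<^sub>1 \<ge> 0 \<and> M\<^sub>2 \<ge> 0 \<and>
     (\<forall>s. \<alpha> - \<delta> \<le> Re s \<and> Re s \<le> \<alpha> \<and> s \<noteq> of_real \<alpha> \<longrightarrow>
        norm ((s - of_real \<alpha>) ^ Suc r * A s) \<le> M\<^sub>1 * exp (norm s powr M\<^sub>2))"
proof (intro exI conjI allI impI)
  define p where "p = real (Suc r + K)"
  define C where "C = (1 + \<alpha>) ^ Suc r * suminf M"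
  have C: "C \<ge> 0" using \<alpha>_pos suminf_M_nonneg by (simp add: C_def)
  show "(fact r + C) * exp (p\<^sup>2) \<ge> 0" using C by simp
  show "(2::real) \<ge> 0" by simp
  fix s :: complex assume s: "\<alpha> - \<delta> \<le> Re s \<and> Re s \<le> \<alpha> \<and> s \<noteq> of_real \<alpha>"
  then have sU: "s \<in> U - {of_real \<alpha>}" using b_bounds by (auto simp: U_def)
  define Y where "Y = 1 + norm s"
  have Y: "Y \<ge> 1" by (simp add: Y_def)
  have "norm (s - of_real \<alpha>) \<le> norm s + \<alpha>" using norm_triangle_ineq4[of s "of_real \<alpha>"] \<alpha>_pos by simp
  then have "norm (s - of_real \<alpha>) \<le> (1 + \<alpha>) * Y" using norm_plus_le[of s] by (simp add: Y_def)
  then have d: "norm (s - of_real \<alpha>) ^ Suc r \<le> (1 + \<alpha>) ^ Suc r * Y ^ Suc r"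
    by (metis norm_ge_zero power_mono power_mult_distrib)
  have "norm (H s) \<le> suminf M * Y powr \<kappa>" using norm_H_le[OF sU] by (simp add: Y_def)
  also have "\<dots> \<le> suminf M * Y ^ K"
    using Y powr_mono[OF \<kappa>_le_K Y] by (intro mult_left_mono suminf_M_nonneg) (simp add: powr_realpow)
  finally have "norm (s - of_real \<alpha>) ^ Suc r * norm (H s) \<le> ((1 + \<alpha>) ^ Suc r * Y ^ Suc r) * (suminf M * Y ^ K)"
    using d \<alpha>_pos Y by (intro mult_mono) auto
  also have "\<dots> = C * Y ^ (Suc r + K)" by (simp add: C_def power_add)
  finally have 1: "norm (s - of_real \<alpha>) ^ Suc r * norm (H s) \<le> C * Y ^ (Suc r + K)" .
  have "Y ^ (Suc r + K) \<le> exp (norm s) ^ (Suc r + K)"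
    unfolding Y_def by (intro power_mono exp_ge_add_one_self) auto
  also have "\<dots> = exp (p * norm s)" by (simp only: p_def exp_of_nat_mult)
  \<comment> \<open>The polynomial growth is traded for the exponent 2: \<open>p * norm s\<close> is
    at most the sum of the squares, and \<open>exp (p\<^sup>2)\<close> goes into the
    constant.\<close>
  also have "\<dots> \<le> exp (p\<^sup>2 + (norm s)\<^sup>2)"
  proof -
    have "0 \<le> (p - norm s)\<^sup>2" "0 \<le> p * norm s" by (simp_all add: p_def)
    then show ?thesis by (simp add: power2_eq_square algebra_simps)
  qed
  also have "\<dots> = exp (p\<^sup>2) * exp (norm s powr 2)" by (simp add: exp_add)
  finally have 2: "Y ^ (Suc r + K) \<le> exp (p\<^sup>2) * exp (norm s powr 2)" .
  have 3: "1 * 1 \<le> exp (p\<^sup>2) * exp (norm s powr 2)" by (intro mult_mono) auto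
  have "norm ((s - of_real \<alpha>) ^ Suc r * A s) = norm (g s)" using s by (simp add: A_eq del: power_Suc)
  also have "\<dots> \<le> fact r + norm (s - of_real \<alpha>) ^ Suc r * norm (H s)"
    unfolding g_def by (rule norm_triangle_le) (simp add: norm_mult norm_power)
  also have "\<dots> \<le> fact r * 1 + C * Y ^ (Suc r + K)" using 1 by simp
  also have "\<dots> \<le> fact r * (exp (p\<^sup>2) * exp (norm s powr 2)) + C * (exp (p\<^sup>2) * exp (norm s powr 2))"
    using 2 3 C by (intro add_mono mult_left_mono) auto
  also have "\<dots> = (fact r + C) * exp (p\<^sup>2) * exp (norm s powr 2)" by (simp add: algebra_simps)
  finally show "norm ((s - of_real \<alpha>) ^ Suc r * A s) \<le> (fact r + C) * exp (p\<^sup>2) * exp (norm s powr 2)" .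
qed

text \<open>On this line the distance to the pole is at least \<delta>, so the pole term is bounded,
  and \<open>H\<close> already grows at the allowed rate.\<close>

lemma A_line_bound:
  "\<exists>C\<ge>1. \<forall>s. Re s = \<alpha> - \<delta> \<longrightarrow> norm (A s) \<le> C * (1 + \<bar>Im s\<bar>) powr \<kappa> * ln (3 + \<bar>Im s\<bar>) ^ r"
proof (intro exI conjI allI impI)
  define C where "C = max 1 (fact r / \<delta> ^ Suc r + suminf M * (1 + \<alpha>) powr \<kappa>)"
  show "C \<ge> 1" by (simp add: C_def)
  fix s assume s: "Re s = \<alpha> - \<delta>"
  then have sU: "s \<in> U - {of_real \<alpha>}" using b_bounds \<delta>_pos by (auto simp: U_def)
  define T where "T = 1 + \<bar>Im s\<bar>"
  have T: "T \<ge> 1" by (simp add: T_def)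
  then have T1: "T powr \<kappa> \<ge> 1" using \<kappa>_pos by (simp add: ge_one_powr_ge_zero)
  have "\<delta> = \<bar>Re (s - of_real \<alpha>)\<bar>" using s \<delta>_pos by simp
  also have "\<dots> \<le> norm (s - of_real \<alpha>)" by (rule abs_Re_le_cmod)
  finally have "\<delta> ^ Suc r \<le> norm (s - of_real \<alpha>) ^ Suc r" using \<delta>_pos by (intro power_mono) auto
  then have 1: "norm (fact r / (s - of_real \<alpha>) ^ Suc r) \<le> fact r / \<delta> ^ Suc r"
    unfolding norm_divide norm_power norm_fact using \<delta>_pos by (intro frac_le) auto
  have "norm s \<le> \<bar>Re s\<bar> + \<bar>Im s\<bar>" by (rule cmod_le)
  then have "1 + norm s \<le> (1 + \<alpha>) + \<bar>Im s\<bar>" using s \<delta>_pos \<delta>_less by simp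
  also have "\<dots> \<le> (1 + \<alpha>) * T" using \<alpha>_pos by (simp add: T_def algebra_simps)
  finally have "(1 + norm s) powr \<kappa> \<le> ((1 + \<alpha>) * T) powr \<kappa>"
    using \<kappa>_pos by (intro powr_mono2) auto
  also have "\<dots> = (1 + \<alpha>) powr \<kappa> * T powr \<kappa>" using \<alpha>_pos T by (simp add: powr_mult)
  finally have "norm (H s) \<le> suminf M * ((1 + \<alpha>) powr \<kappa> * T powr \<kappa>)"
    using norm_H_le[OF sU] suminf_M_nonneg by (meson mult_left_mono order_trans)
  then have "norm (A s) \<le> fact r / \<delta> ^ Suc r * 1 + suminf M * (1 + \<alpha>) powr \<kappa> * T powr \<kappa>"
    unfolding A_def using 1 norm_triangle_ineq[of "fact r / (s - of_real \<alpha>) ^ Suc r" "H s"] by simp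
  also have "\<dots> \<le> fact r / \<delta> ^ Suc r * T powr \<kappa> + suminf M * (1 + \<alpha>) powr \<kappa> * T powr \<kappa>"
    using T1 \<delta>_pos suminf_M_nonneg by (intro add_mono mult_left_mono) auto
  also have "\<dots> = (fact r / \<delta> ^ Suc r + suminf M * (1 + \<alpha>) powr \<kappa>) * T powr \<kappa>" by (simp add: algebra_simps)
  also have "\<dots> \<le> C * T powr \<kappa> * 1" by (auto simp: C_def intro!: mult_right_mono)
  also have "\<dots> \<le> C * T powr \<kappa> * ln (3 + \<bar>Im s\<bar>) ^ r"
  proof (intro mult_left_mono one_le_power)
    \<comment> \<open>As 3 exceeds e, the logarithm is at least 1 and its power can be inserted for
      free.\<close>
    have "exp 1 \<le> (3::real)" using exp_le by simp
    then show "1 \<le> ln (3 + \<bar>Im s\<bar>)" by (subst ln_ge_iff) auto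
  qed (simp add: C_def)
  finally show "norm (A s) \<le> C * (1 + \<bar>Im s\<bar>) powr \<kappa> * ln (3 + \<bar>Im s\<bar>) ^ r" by (simp add: T_def)
qed

lemma hypothesis_B_A: "hypothesis_B lam a A \<alpha> \<delta> \<kappa> (Suc r)"
  unfolding hypothesis_B_def
  using \<alpha>_pos \<delta>_pos \<delta>_less \<kappa>_pos frequency_seq_lam a_nonneg a_sums A_analytic A_pole A_zorder
    A_strip_bound A_line_bound
  by auto

section \<open>The two lower bounds\<close>

definition "G x = x powr (\<alpha> - \<theta>) * ln x ^ r"

text \<open>The large coefficients are those at the block starts, where
  \<open>lam n = exp j\<close>.\<close>

lemma frequently_a_ge:
  "\<exists>\<^sub>F n in sequentially. a n \<ge> 1 / (2 ^ Suc K * real (Suc K)) * G (lam n) \<and> G (lam n) > 0"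
  unfolding frequently_sequentially
proof
  fix n0 :: nat
  \<comment> \<open>Taking \<open>j > 0\<close> makes \<open>real j ^ r\<close>, hence
    \<open>G (lam n)\<close>, positive.\<close>
  define j where "j = Suc n0"
  define n where "n = block_start N j"
  have "lam n = exp (real j)" unfolding lam_def n_def using block_point_start[of N j] N_pos by simp
  then have G: "G (lam n) = real j ^ r * exp ((\<alpha> - \<theta>) * real j)" by (simp add: G_def powr_def)
  have "a n = coef j 0"
    unfolding a_def n_def using block_index_start_add[of 0 N j] block_offset_start_add[of 0 N j] N_pos[of j] by simp
  then have "a n \<ge> 1 / (2 ^ Suc K * real (Suc K)) * G (lam n)" using coef_0_ge[of j] G by simp
  moreover have "G (lam n) > 0" unfolding G by (simp add: j_def)
  moreover have "n \<ge> n0"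
    using strict_mono_imp_increasing[OF strict_mono_block_start[of N], of j] N_pos by (simp add: n_def j_def)
  ultimately show "\<exists>n\<ge>n0. a n \<ge> 1 / (2 ^ Suc K * real (Suc K)) * G (lam n) \<and> G (lam n) > 0" by blast
qed

lemma omega_coefficients: "omega_limsup sequentially a (\<lambda>n. G (lam n))"
proof (rule omega_limsupI)
  show "1 / (2 ^ Suc K * real (Suc K)) > 0" by simp
  show "\<exists>\<^sub>F n in sequentially. norm (a n) \<ge> 1 / (2 ^ Suc K * real (Suc K)) * norm (G (lam n)) \<and> G (lam n) \<noteq> 0"
    using frequently_a_ge by (rule frequently_elim1) (use a_nonneg in auto)
qed

lemma continuous_on_residue_A:
  "continuous_on {1<..} (\<lambda>x::real. residue (\<lambda>s. A s * (of_real x powr s / s)) (of_real \<alpha>))"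
proof -
  \<comment> \<open>As \<open>b \<le> \<alpha>\<close>, the real part is positive on
    \<open>U\<close>; so \<open>g s / s\<close> is holomorphic there.\<close>
  have nz: "s \<noteq> 0" if "s \<in> U" for s using that b_bounds by (auto simp: U_def)
  have eq: "residue (\<lambda>s. A s * (of_real x powr s / s)) (of_real \<alpha>) =
      residue (\<lambda>s. g s / s * of_real x powr s / (s - of_real \<alpha>) ^ Suc r) (of_real \<alpha>)" for x :: real
  proof (rule residue_cong)
    have "\<forall>\<^sub>F s in at (of_real \<alpha>). s \<noteq> complex_of_real \<alpha>" by (simp add: eventually_at_filter)
    then show "\<forall>\<^sub>F s in at (of_real \<alpha>). A s * (of_real x powr s / s) =
        g s / s * of_real x powr s / (s - of_real \<alpha>) ^ Suc r"
      by eventually_elim (simp add: A_eq)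
  qed simp
  have "continuous_on {0<..} (\<lambda>x::real. residue (\<lambda>s. g s / s * of_real x powr s / (s - of_real \<alpha>) ^ Suc r) (of_real \<alpha>))"
    using nz by (intro continuous_on_residue_powr[OF open_U \<alpha>_in_U] holomorphic_intros g_holomorphic) auto
  then show ?thesis unfolding eq by (rule continuous_on_subset) auto
qed

lemma omega_partial_sums:
  "omega_limsup at_top (\<lambda>x::real. of_real (\<Sum>n | lam n \<le> x. a n)
     - residue (\<lambda>s. A s * (of_real x powr s / s)) (of_real \<alpha>)) (\<lambda>x. of_real (G x))"
proof (rule omega_limsup_partial_sums[OF frequency_seq_lam continuous_on_residue_A])
  show "continuous_on {1<..} G"
    unfolding G_def[abs_def] by (intro continuous_intros) auto
  show "G x > 0" if "x > 1" for x using that by (simp add: G_def)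
  show "1 / (2 ^ Suc K * real (Suc K)) > 0" by simp
  show "\<exists>\<^sub>F n in sequentially. a n \<ge> 1 / (2 ^ Suc K * real (Suc K)) * G (lam n)"
    using frequently_a_ge by (rule frequently_elim1) auto
qed

end

theorem theoremB4:
  fixes \<alpha> \<delta> \<kappa> :: real and m :: nat
  assumes "\<alpha> > 0" and "0 < \<delta>" and "\<delta> < \<alpha>" and "\<kappa> > 1 / 2" and "m \<ge> 1"
  shows "\<exists>(lam :: nat \<Rightarrow> real) (a :: nat \<Rightarrow> real) (A :: complex \<Rightarrow> complex).
    frequency_seq lam \<and> (\<forall>n. a n \<ge> 0) \<and>
    hypothesis_B lam a A \<alpha> \<delta> \<kappa> m \<and>
    omega_limsup sequentially a
      (\<lambda>n. lam n powr (\<alpha> - \<delta> / (\<kappa> + 1 / 2)) * ln (lam n) ^ (m - 1)) \<and>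
    omega_limsup at_top
      (\<lambda>x::real. complex_of_real (\<Sum>n | lam n \<le> x. a n)
         - residue (\<lambda>s. A s * (complex_of_real x powr s / s)) (complex_of_real \<alpha>))
      (\<lambda>x. complex_of_real (x powr (\<alpha> - \<delta> / (\<kappa> + 1 / 2)) * ln x ^ (m - 1)))"
proof -
  \<comment> \<open>The parameter \<open>r\<close> is the exponent \<open>m - 1\<close> of the
    logarithm; the pole order \<open>Suc r\<close> is then \<open>m\<close>.\<close>
  interpret spiked_series \<alpha> \<delta> \<kappa> "m - 1"
    by unfold_locales (use assms in auto)
  have m: "Suc (m - 1) = m" using assms(5) by simp
  show ?thesis
    using frequency_seq_lam a_nonneg hypothesis_B_A[unfolded m]
      omega_coefficients[unfolded G_def \<theta>_def] omega_partial_sums[unfolded G_def \<theta>_def]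
    by blast
qed

end
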